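(* Let $m\ge 1$ and let $\bm{\alpha}_0=(\alpha_0^{(1)},\ldots,\alpha_0^{(m)})\in\mathbb{Q}_p^m$ be such that $1,\alpha_0^{(1)},\ldots,\alpha_0^{(m)}$ are $\mathbb{Q}$-linearly dependent. Assume that the partial quotients $a_n^{(j)}$ produced by the $p$-adic Jacobi--Perron algorithm on input $\bm{\alpha}_0$ (with the convention $a_n^{(m+1)}=1$) satisfy $$v_p(a^{(j)}_n)-v_p(a^{(1)}_n)\geq j-1\quad\text{for } j=3,\ldots,m+1 \text{ and all sufficiently large } n .$$ Then the $p$-adic Jacobi--Perron algorithm stops in finitely many steps when processing the input $(\alpha_0^{(1)},\ldots,\alpha_0^{(m)})$.
   Context: Let $p$ be an odd prime and $v_p$ the $p$-adic valuation on $\mathbb{Q}_p$ (with $v_p(0)=+\infty$). Every $\alpha\in\mathbb{Q}_p$ can be written uniquely as $\alpha=\sum_{j=k}^{\infty}x_jp^j$ with $k\in\mathbb{Z}$ and $x_j\in\mathbb{Z}\cap(-\frac p2,\frac p2)$. The Browkin $s$-function is $s(\alpha)=\sum_{j=k}^{0}x_jp^j$ (the sum of the terms with $j\le 0$; it is $0$ if there are none). $p$-adic Jacobi--Perron algorithm of dimension $m$: on input $\bm{\alpha}_0=(\alpha_0^{(1)},\ldots,\alpha_0^{(m)})\in\mathbb{Q}_p^m$, for $n=0,1,2,\ldots$ put $a_n^{(i)}=s(\alpha_n^{(i)})$ for $i=1,\ldots,m$ (the partial quotients). If $\alpha_n^{(m)}=a_n^{(m)}$ the algorithm stops; otherwise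 set $\alpha_{n+1}^{(1)}=\dfrac{1}{\alpha_n^{(m)}-a_n^{(m)}}$ and $\alpha_{n+1}^{(i)}=\dfrac{\alpha_n^{(i-1)}-a_n^{(i-1)}}{\alpha_n^{(m)}-a_n^{(m)}}$ for $i=2,\ldots,m$, and continue. By convention $\alpha_n^{(m+1)}=a_n^{(m+1)}=1$ for every $n$. *)

theory Defs
  imports
    "HOL-Analysis.Analysis"
    "HOL-Library.Extended"
    "Berlekamp_Zassenhaus.Finite_Field"
begin

section \<open>The p-adic absolute value on the rationals\<close>

definition rat_padic_val :: "nat \<Rightarrow> rat \<Rightarrow> int" where
  "rat_padic_val p x =
     int (multiplicity (int p) (fst (quotient_of x))) -
     int (multiplicity (int p) (snd (quotient_of x)))"

definition rat_padic_abs :: "nat \<Rightarrow> rat \<Rightarrow> real" where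
  "rat_padic_abs p x = (if x = 0 then 0 else real p powi (- rat_padic_val p x))"

lemma rat_padic_abs_0 [simp]: "rat_padic_abs p 0 = 0"
  by (simp add: rat_padic_abs_def)

lemma rat_frac_cases:
  fixes x :: rat
  obtains a b :: int where "b > 0" "x = of_int a / of_int b"
  using quotient_of_div quotient_of_denom_pos by (metis surj_pair)

context
  fixes p :: nat
  assumes p: "prime p"
begin

lemma rat_padic_val_frac:
  assumes "a \<noteq> 0" "b \<noteq> 0"
  shows "rat_padic_val p (of_int a / of_int b) =
    int (multiplicity (int p) a) - int (multiplicity (int p) b)"
proof -
  obtain c d where q: "quotient_of (of_int a / of_int b) = (c, d)"
    by (cases "quotient_of (of_int a / of_int b :: rat)")
  have d: "d > 0" using q by (rule quotient_of_denom_pos)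
  have eq: "(of_int a / of_int b :: rat) = of_int c / of_int d"
    using q by (rule quotient_of_div)
  have "(of_int (a * d) :: rat) = of_int (c * b)"
    using eq assms d by (simp add: field_simps)
  then have cd: "a * d = c * b" by (simp only: of_int_eq_iff)
  then have c: "c \<noteq> 0" using assms d by auto
  have pp: "prime_elem (int p)" using p by auto
  have "multiplicity (int p) (a * d) = multiplicity (int p) a + multiplicity (int p) d"
    using assms d by (intro prime_elem_multiplicity_mult_distrib[OF pp]) auto
  moreover have "multiplicity (int p) (c * b) = multiplicity (int p) c + multiplicity (int p) b"
    using assms c by (intro prime_elem_multiplicity_mult_distrib[OF pp]) auto
  ultimately have "multiplicity (int p) a + multiplicity (int p) d =
      multiplicity (int p) c + multiplicity (int p) b"
    using cd by simp
  then show ?thesis using q by (simp add: rat_padic_val_def)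
qed

lemma rat_padic_val_mult:
  assumes "x \<noteq> 0" "y \<noteq> 0"
  shows "rat_padic_val p (x * y) = rat_padic_val p x + rat_padic_val p y"
proof -
  obtain a b where x: "b > 0" "x = of_int a / of_int b" by (rule rat_frac_cases)
  obtain c d where y: "d > 0" "y = of_int c / of_int d" by (rule rat_frac_cases)
  have nz: "a \<noteq> 0" "c \<noteq> 0" using x y assms by auto
  have xy: "x * y = of_int (a * c) / of_int (b * d)" using x y by simp
  have pp: "prime_elem (int p)" using p by auto
  have "rat_padic_val p (x * y) =
      int (multiplicity (int p) (a * c)) - int (multiplicity (int p) (b * d))"
    unfolding xy using nz x y by (intro rat_padic_val_frac) auto
  also have "\<dots> = rat_padic_val p x + rat_padic_val p y"
    using nz x y by (simp add: rat_padic_val_frac prime_elem_multiplicity_mult_distrib[OF pp])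
  finally show ?thesis .
qed

lemma rat_padic_abs_mult: "rat_padic_abs p (x * y) = rat_padic_abs p x * rat_padic_abs p y"
proof (cases "x = 0 \<or> y = 0")
  case True
  then show ?thesis by auto
next
  case False
  moreover have "real p \<noteq> 0" using p by auto
  ultimately show ?thesis
    by (simp add: rat_padic_abs_def rat_padic_val_mult power_int_add[symmetric] add.commute)
qed

lemma rat_padic_abs_nonneg [simp]: "rat_padic_abs p x \<ge> 0"
  by (simp add: rat_padic_abs_def)

lemma rat_padic_abs_eq_0 [simp]: "rat_padic_abs p x = 0 \<longleftrightarrow> x = 0"
  using p by (auto simp: rat_padic_abs_def power_int_eq_0_iff)

lemma rat_padic_abs_1 [simp]: "rat_padic_abs p 1 = 1"
  using rat_padic_val_frac[of 1 1] by (simp add: rat_padic_abs_def)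

lemma rat_padic_abs_neg [simp]: "rat_padic_abs p (- x) = rat_padic_abs p x"
proof -
  have "rat_padic_abs p (-1) * rat_padic_abs p (-1) = 1"
    using rat_padic_abs_mult[of "-1" "-1"] by simp
  then have "(rat_padic_abs p (-1) - 1) * (rat_padic_abs p (-1) + 1) = 0"
    by (simp add: algebra_simps)
  moreover have "rat_padic_abs p (-1) + 1 \<noteq> 0"
    using rat_padic_abs_nonneg[of "-1"] by linarith
  ultimately have "rat_padic_abs p (-1) = 1" by simp
  then show ?thesis using rat_padic_abs_mult[of "-1" x] by simp
qed

lemma rat_padic_abs_minus_commute: "rat_padic_abs p (x - y) = rat_padic_abs p (y - x)"
  using rat_padic_abs_neg[of "x - y"] by simp

lemma rat_padic_abs_inverse: "rat_padic_abs p (inverse x) = inverse (rat_padic_abs p x)"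
proof (cases "x = 0")
  case False
  then have "rat_padic_abs p x * rat_padic_abs p (inverse x) = 1"
    by (simp add: rat_padic_abs_mult[symmetric])
  then show ?thesis by (simp add: inverse_unique)
qed simp

lemma rat_padic_abs_add: "rat_padic_abs p (x + y) \<le> max (rat_padic_abs p x) (rat_padic_abs p y)"
proof (cases "x = 0 \<or> y = 0 \<or> x + y = 0")
  case True
  then show ?thesis by (auto simp: le_max_iff_disj)
next
  case False
  obtain a0 b0 where x: "b0 > 0" "x = of_int a0 / of_int b0" by (rule rat_frac_cases)
  obtain c0 d0 where y: "d0 > 0" "y = of_int c0 / of_int d0" by (rule rat_frac_cases)
  define a c d where "a = a0 * d0" "c = c0 * b0" "d = b0 * d0"
  have d: "d \<noteq> 0" using x y unfolding a_c_d_def by simp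
  have X: "x = of_int a / of_int d" and Y: "y = of_int c / of_int d"
    using x y by (auto simp: a_c_d_def)
  have XY: "x + y = of_int (a + c) / of_int d"
    by (simp add: X Y add_divide_distrib)
  have nz: "a \<noteq> 0" "c \<noteq> 0" "a + c \<noteq> 0"
    using False X Y XY by (auto simp del: of_int_add)
  define k where "k = min (multiplicity (int p) a) (multiplicity (int p) c)"
  have "int p ^ k dvd a" "int p ^ k dvd c"
    by (auto simp: k_def intro: multiplicity_dvd')
  then have "int p ^ k dvd a + c" by simp
  then have "k \<le> multiplicity (int p) (a + c)"
    using nz p by (intro multiplicity_geI) auto
  then have "rat_padic_val p x \<le> rat_padic_val p (x + y) \<or>
      rat_padic_val p y \<le> rat_padic_val p (x + y)"
    using rat_padic_val_frac[OF nz(1) d] rat_padic_val_frac[OF nz(2) d]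
      rat_padic_val_frac[OF nz(3) d]
    by (simp only: X[symmetric] Y[symmetric] XY[symmetric])
       (auto simp: k_def min_def split: if_splits)
  moreover have "real p \<ge> 1" using prime_ge_1_nat[OF p] by simp
  ultimately show ?thesis
    using False by (auto simp: rat_padic_abs_def le_max_iff_disj intro!: power_int_increasing)
qed

lemma rat_padic_abs_triangle: "rat_padic_abs p (x + y) \<le> rat_padic_abs p x + rat_padic_abs p y"
  using rat_padic_abs_add[of x y] rat_padic_abs_nonneg[of x] rat_padic_abs_nonneg[of y] by linarith

lemma rat_padic_abs_diff: "\<bar>rat_padic_abs p x - rat_padic_abs p y\<bar> \<le> rat_padic_abs p (x - y)"
  using rat_padic_abs_triangle[of "x - y" y] rat_padic_abs_triangle[of "y - x" x]
  by (simp add: rat_padic_abs_minus_commute[of y x])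

lemma rat_padic_abs_of_int_le_1: "rat_padic_abs p (of_int k) \<le> 1"
proof (cases "k = 0")
  case False
  have "real p \<ge> 1" using prime_ge_1_nat[OF p] by simp
  then show ?thesis
    using False rat_padic_val_frac[of k 1]
    by (auto simp: rat_padic_abs_def power_int_minus inverse_le_1_iff one_le_power)
qed simp

lemma rat_padic_abs_of_int_lt_1: "rat_padic_abs p (of_int k) < 1 \<longleftrightarrow> int p dvd k"
proof (cases "k = 0")
  case False
  have p1: "real p > 1" using prime_gt_1_nat[OF p] by simp
  have "int p dvd k \<longleftrightarrow> multiplicity (int p) k > 0"
    using False p by (subst prime_multiplicity_gt_zero_iff) auto
  also have "\<dots> \<longleftrightarrow> rat_padic_abs p (of_int k) < 1"
    using False p1 rat_padic_val_frac[of k 1]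
    by (cases "multiplicity (int p) k = 0")
       (auto simp: rat_padic_abs_def power_int_minus inverse_less_1_iff one_less_power)
  finally show ?thesis by simp
qed simp

lemma rat_padic_abs_p: "rat_padic_abs p (of_nat p) = inverse (real p)"
proof -
  have "rat_padic_val p (of_int (int p) / of_int 1) = 1"
    using p by (subst rat_padic_val_frac) auto
  then show ?thesis using p by (auto simp: rat_padic_abs_def power_int_minus)
qed

end


section \<open>The field of p-adic numbers as the completion of the rationals\<close>

definition padic_cauchy :: "nat \<Rightarrow> (nat \<Rightarrow> rat) \<Rightarrow> bool" where
  "padic_cauchy p X \<longleftrightarrow> (\<forall>e>0. \<exists>M. \<forall>m\<ge>M. \<forall>n\<ge>M. rat_padic_abs p (X m - X n) < e)"

definition padic_null :: "nat \<Rightarrow> (nat \<Rightarrow> rat) \<Rightarrow> bool" where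
  "padic_null p X \<longleftrightarrow> (\<lambda>n. rat_padic_abs p (X n)) \<longlonglongrightarrow> 0"

definition padic_rel :: "nat \<Rightarrow> (nat \<Rightarrow> rat) \<Rightarrow> (nat \<Rightarrow> rat) \<Rightarrow> bool" where
  "padic_rel p X Y \<longleftrightarrow> padic_cauchy p X \<and> padic_cauchy p Y \<and> padic_null p (\<lambda>n. X n - Y n)"

context
  fixes p :: nat
  assumes p: "prime p"
begin

lemma padic_cauchy_const [simp]: "padic_cauchy p (\<lambda>_. c)"
  by (simp add: padic_cauchy_def)

lemma padic_null_le:
  assumes "padic_null p X" "\<And>n. rat_padic_abs p (Y n) \<le> rat_padic_abs p (X n) * B"
  shows "padic_null p Y"
proof -
  have "(\<lambda>n. rat_padic_abs p (X n) * B) \<longlonglongrightarrow> 0 * B"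
    using assms(1) unfolding padic_null_def by (intro tendsto_mult tendsto_const)
  then have "(\<lambda>n. rat_padic_abs p (X n) * B) \<longlonglongrightarrow> 0" by simp
  then show ?thesis
    unfolding padic_null_def
    by (rule Lim_null_comparison[rotated]) (auto simp: assms(2) rat_padic_abs_nonneg[OF p])
qed

lemma padic_null_add:
  assumes "padic_null p X" "padic_null p Y"
  shows "padic_null p (\<lambda>n. X n + Y n)"
proof -
  have "(\<lambda>n. rat_padic_abs p (X n) + rat_padic_abs p (Y n)) \<longlonglongrightarrow> 0 + 0"
    using assms unfolding padic_null_def by (rule tendsto_add)
  then have "(\<lambda>n. rat_padic_abs p (X n) + rat_padic_abs p (Y n)) \<longlonglongrightarrow> 0" by simp
  then show ?thesis
    unfolding padic_null_def
    by (rule Lim_null_comparison[rotated])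
       (auto simp: rat_padic_abs_triangle[OF p] rat_padic_abs_nonneg[OF p])
qed

lemma padic_null_minus: "padic_null p (\<lambda>n. - X n) \<longleftrightarrow> padic_null p X"
  by (simp add: padic_null_def rat_padic_abs_neg[OF p])

lemma padic_null_diff_commute: "padic_null p (\<lambda>n. X n - Y n) \<longleftrightarrow> padic_null p (\<lambda>n. Y n - X n)"
  by (simp add: padic_null_def rat_padic_abs_minus_commute[OF p])

lemma padic_cauchy_abs_Cauchy:
  assumes "padic_cauchy p X"
  shows "Cauchy (\<lambda>n. rat_padic_abs p (X n))"
  unfolding Cauchy_def
proof (intro allI impI)
  fix e :: real assume "e > 0"
  then obtain M where "\<forall>m\<ge>M. \<forall>n\<ge>M. rat_padic_abs p (X m - X n) < e"
    using assms unfolding padic_cauchy_def by blast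
  then have "\<forall>m\<ge>M. \<forall>n\<ge>M. dist (rat_padic_abs p (X m)) (rat_padic_abs p (X n)) < e"
    unfolding dist_real_def by (meson rat_padic_abs_diff[OF p] le_less_trans)
  then show "\<exists>M. \<forall>m\<ge>M. \<forall>n\<ge>M. dist (rat_padic_abs p (X m)) (rat_padic_abs p (X n)) < e" ..
qed

lemma padic_cauchy_bounded:
  assumes "padic_cauchy p X"
  obtains B where "B > 0" "\<And>n. rat_padic_abs p (X n) < B"
proof -
  have "Bseq (\<lambda>n. rat_padic_abs p (X n))"
    using padic_cauchy_abs_Cauchy[OF assms] by (rule Cauchy_Bseq)
  then obtain B where "B > 0" "\<forall>n. norm (rat_padic_abs p (X n)) < B"
    using BseqD by (metis Bseq_def gt_ex order_le_less_trans order_less_trans)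
  then show ?thesis using that[of B] by (auto simp: rat_padic_abs_nonneg[OF p])
qed

lemma padic_cauchy_add:
  assumes "padic_cauchy p X" "padic_cauchy p Y"
  shows "padic_cauchy p (\<lambda>n. X n + Y n)"
  unfolding padic_cauchy_def
proof (intro allI impI)
  fix e :: real assume e: "e > 0"
  obtain M where M: "\<forall>m\<ge>M. \<forall>n\<ge>M. rat_padic_abs p (X m - X n) < e"
    using assms e unfolding padic_cauchy_def by blast
  obtain N where N: "\<forall>m\<ge>N. \<forall>n\<ge>N. rat_padic_abs p (Y m - Y n) < e"
    using assms e unfolding padic_cauchy_def by blast
  have "rat_padic_abs p (X m + Y m - (X n + Y n)) < e" if "m \<ge> max M N" "n \<ge> max M N" for m n
    using rat_padic_abs_add[OF p, of "X m - X n" "Y m - Y n"] M N that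
    by (simp add: algebra_simps) (smt (verit))
  then show "\<exists>K. \<forall>m\<ge>K. \<forall>n\<ge>K. rat_padic_abs p (X m + Y m - (X n + Y n)) < e" by blast
qed

lemma padic_cauchy_minus:
  assumes "padic_cauchy p X"
  shows "padic_cauchy p (\<lambda>n. - X n)"
  using assms rat_padic_abs_minus_commute[OF p] by (simp add: padic_cauchy_def)

lemma padic_cauchy_mult:
  assumes "padic_cauchy p X" "padic_cauchy p Y"
  shows "padic_cauchy p (\<lambda>n. X n * Y n)"
  unfolding padic_cauchy_def
proof (intro allI impI)
  fix e :: real assume e: "e > 0"
  obtain B where B: "B > 0" "\<And>n. rat_padic_abs p (X n) < B"
    using padic_cauchy_bounded[OF assms(1)] by blast
  obtain C where C: "C > 0" "\<And>n. rat_padic_abs p (Y n) < C"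
    using padic_cauchy_bounded[OF assms(2)] by blast
  obtain M where M: "\<forall>m\<ge>M. \<forall>n\<ge>M. rat_padic_abs p (X m - X n) < e / C"
    using assms e C unfolding padic_cauchy_def by (metis divide_pos_pos)
  obtain N where N: "\<forall>m\<ge>N. \<forall>n\<ge>N. rat_padic_abs p (Y m - Y n) < e / B"
    using assms e B unfolding padic_cauchy_def by (metis divide_pos_pos)
  have "rat_padic_abs p (X m * Y m - X n * Y n) < e" if mn: "m \<ge> max M N" "n \<ge> max M N" for m n
  proof -
    have "rat_padic_abs p ((X m - X n) * Y m) \<le> rat_padic_abs p (X m - X n) * C"
      unfolding rat_padic_abs_mult[OF p]
      using C(2)[of m] by (intro mult_left_mono) (auto simp: rat_padic_abs_nonneg[OF p])
    also have "\<dots> < e" using M mn C(1) by (simp add: pos_less_divide_eq)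
    finally have 1: "rat_padic_abs p ((X m - X n) * Y m) < e" .
    have "rat_padic_abs p ((Y m - Y n) * X n) \<le> rat_padic_abs p (Y m - Y n) * B"
      unfolding rat_padic_abs_mult[OF p]
      using B(2)[of n] by (intro mult_left_mono) (auto simp: rat_padic_abs_nonneg[OF p])
    also have "\<dots> < e" using N mn B(1) by (simp add: pos_less_divide_eq)
    finally have 2: "rat_padic_abs p ((Y m - Y n) * X n) < e" .
    have "X m * Y m - X n * Y n = (X m - X n) * Y m + (Y m - Y n) * X n"
      by (simp add: algebra_simps)
    then show ?thesis
      using 1 2 rat_padic_abs_add[OF p, of "(X m - X n) * Y m" "(Y m - Y n) * X n"] by simp
  qed
  then show "\<exists>K. \<forall>m\<ge>K. \<forall>n\<ge>K. rat_padic_abs p (X m * Y m - X n * Y n) < e" by blast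
qed

lemma padic_cauchy_not_null:
  assumes X: "padic_cauchy p X" and nn: "\<not> padic_null p X"
  obtains c N where "c > 0" "\<And>n. n \<ge> N \<Longrightarrow> rat_padic_abs p (X n) = c"
proof -
  obtain l where l: "(\<lambda>n. rat_padic_abs p (X n)) \<longlonglongrightarrow> l"
    using padic_cauchy_abs_Cauchy[OF X] Cauchy_convergent convergent_def by blast
  have "l \<ge> 0" using l by (rule LIMSEQ_le_const) (auto simp: rat_padic_abs_nonneg[OF p])
  moreover have "l \<noteq> 0" using nn l unfolding padic_null_def by auto
  ultimately have "l > 0" by simp
  then obtain M where M: "\<And>n. n \<ge> M \<Longrightarrow> rat_padic_abs p (X n) > l / 2"
    using order_tendstoD(1)[OF l, of "l / 2"] unfolding eventually_sequentially by auto
  obtain N where N: "\<And>m n. m \<ge> N \<Longrightarrow> n \<ge> N \<Longrightarrow> rat_padic_abs p (X m - X n) < l / 2"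
    using X \<open>l > 0\<close> unfolding padic_cauchy_def by (meson half_gt_zero)
  define K where "K = max M N"
  have "rat_padic_abs p (X n) = rat_padic_abs p (X K)" if "n \<ge> K" for n
  proof -
    have "rat_padic_abs p (X n - X K) < l / 2" "rat_padic_abs p (X K - X n) < l / 2"
      using that N[of n K] N[of K n] by (auto simp: K_def)
    moreover have "rat_padic_abs p (X n) > l / 2" "rat_padic_abs p (X K) > l / 2"
      using that M[of n] M[of K] by (auto simp: K_def)
    ultimately show ?thesis
      using rat_padic_abs_add[OF p, of "X n - X K" "X K"]
        rat_padic_abs_add[OF p, of "X K - X n" "X n"] by auto
  qed
  moreover have "rat_padic_abs p (X K) > 0" using M[of K] \<open>l > 0\<close> by (auto simp: K_def)
  ultimately show ?thesis using that by blast
qed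

lemma padic_cauchy_inverse:
  assumes X: "padic_cauchy p X" and nn: "\<not> padic_null p X"
  shows "padic_cauchy p (\<lambda>n. inverse (X n))"
  unfolding padic_cauchy_def
proof (intro allI impI)
  fix e :: real assume e: "e > 0"
  obtain c N where c: "c > 0" "\<And>n. n \<ge> N \<Longrightarrow> rat_padic_abs p (X n) = c"
    using padic_cauchy_not_null[OF assms] by blast
  then obtain M where M: "\<And>m n. m \<ge> M \<Longrightarrow> n \<ge> M \<Longrightarrow> rat_padic_abs p (X m - X n) < e * (c * c)"
    using X e unfolding padic_cauchy_def by (metis mult_pos_pos)
  have "rat_padic_abs p (inverse (X m) - inverse (X n)) < e" if mn: "m \<ge> max M N" "n \<ge> max M N" for m n
  proof -
    have cc: "rat_padic_abs p (X m) = c" "rat_padic_abs p (X n) = c" using mn c by auto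
    then have nz: "X m \<noteq> 0" "X n \<noteq> 0" using c(1) by auto
    have "inverse (X m) - inverse (X n) = (X n - X m) * inverse (X m) * inverse (X n)"
      using nz by (simp add: field_simps)
    then have "rat_padic_abs p (inverse (X m) - inverse (X n)) =
        rat_padic_abs p (X n - X m) * inverse c * inverse c"
      using cc by (simp only: rat_padic_abs_mult[OF p] rat_padic_abs_inverse[OF p])
    also have "\<dots> < e" using M[of n m] mn c(1) by (simp add: field_simps)
    finally show ?thesis .
  qed
  then show "\<exists>K. \<forall>m\<ge>K. \<forall>n\<ge>K. rat_padic_abs p (inverse (X m) - inverse (X n)) < e" by blast
qed

lemma padic_rel_refl: "padic_cauchy p X \<Longrightarrow> padic_rel p X X"
  by (simp add: padic_rel_def padic_null_def)

lemma padic_rel_sym: "padic_rel p X Y \<Longrightarrow> padic_rel p Y X"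
  using padic_null_diff_commute by (auto simp: padic_rel_def)

lemma padic_rel_trans: "padic_rel p X Y \<Longrightarrow> padic_rel p Y Z \<Longrightarrow> padic_rel p X Z"
  using padic_null_add[of "\<lambda>n. X n - Y n" "\<lambda>n. Y n - Z n"] by (simp add: padic_rel_def)

lemma padic_rel_part_equivp: "part_equivp (padic_rel p)"
proof (rule part_equivpI)
  show "\<exists>X. padic_rel p X X" using padic_rel_refl padic_cauchy_const by blast
  show "symp (padic_rel p)" using padic_rel_sym by (auto intro: sympI)
  show "transp (padic_rel p)" using padic_rel_trans by (auto intro: transpI)
qed

lemma padic_rel_add:
  assumes "padic_rel p X X'" "padic_rel p Y Y'"
  shows "padic_rel p (\<lambda>n. X n + Y n) (\<lambda>n. X' n + Y' n)"
  using assms padic_null_add[of "\<lambda>n. X n - X' n" "\<lambda>n. Y n - Y' n"]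
  by (auto simp: padic_rel_def padic_cauchy_add algebra_simps)

lemma padic_rel_minus:
  assumes "padic_rel p X X'"
  shows "padic_rel p (\<lambda>n. - X n) (\<lambda>n. - X' n)"
  using assms padic_null_minus[of "\<lambda>n. X n - X' n"] padic_null_diff_commute[of X X']
  by (auto simp: padic_rel_def padic_cauchy_minus)

lemma padic_rel_mult:
  assumes "padic_rel p X X'" "padic_rel p Y Y'"
  shows "padic_rel p (\<lambda>n. X n * Y n) (\<lambda>n. X' n * Y' n)"
proof -
  obtain B where B: "B > 0" "\<And>n. rat_padic_abs p (Y n) < B"
    using assms padic_cauchy_bounded[of Y] by (auto simp: padic_rel_def)
  obtain C where C: "C > 0" "\<And>n. rat_padic_abs p (X' n) < C"
    using assms padic_cauchy_bounded[of X'] by (auto simp: padic_rel_def)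
  have "padic_null p (\<lambda>n. (X n - X' n) * Y n)"
  proof (rule padic_null_le[of "\<lambda>n. X n - X' n" _ B])
    show "padic_null p (\<lambda>n. X n - X' n)" using assms by (simp add: padic_rel_def)
    show "rat_padic_abs p ((X n - X' n) * Y n) \<le> rat_padic_abs p (X n - X' n) * B" for n
      unfolding rat_padic_abs_mult[OF p]
      using B(2)[of n] by (intro mult_left_mono rat_padic_abs_nonneg[OF p]) simp
  qed
  moreover have "padic_null p (\<lambda>n. (Y n - Y' n) * X' n)"
  proof (rule padic_null_le[of "\<lambda>n. Y n - Y' n" _ C])
    show "padic_null p (\<lambda>n. Y n - Y' n)" using assms by (simp add: padic_rel_def)
    show "rat_padic_abs p ((Y n - Y' n) * X' n) \<le> rat_padic_abs p (Y n - Y' n) * C" for n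
      unfolding rat_padic_abs_mult[OF p]
      using C(2)[of n] by (intro mult_left_mono rat_padic_abs_nonneg[OF p]) simp
  qed
  ultimately have "padic_null p (\<lambda>n. (X n - X' n) * Y n + (Y n - Y' n) * X' n)"
    by (rule padic_null_add)
  moreover have "(\<lambda>n. (X n - X' n) * Y n + (Y n - Y' n) * X' n) = (\<lambda>n. X n * Y n - X' n * Y' n)"
    by (simp add: algebra_simps)
  ultimately show ?thesis
    using assms by (simp add: padic_rel_def padic_cauchy_mult)
qed

lemma padic_rel_null_iff:
  assumes "padic_rel p X Y"
  shows "padic_null p X \<longleftrightarrow> padic_null p Y"
  using assms padic_null_add[of "\<lambda>n. X n - Y n" Y] padic_null_add[of "\<lambda>n. Y n - X n" X]
    padic_null_diff_commute[of X Y]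
  by (auto simp: padic_rel_def)

lemma padic_mult_inverse:
  assumes X: "padic_cauchy p X" and nn: "\<not> padic_null p X"
  shows "padic_rel p (\<lambda>n. inverse (X n) * X n) (\<lambda>_. 1)"
proof -
  obtain c N where c: "c > 0" "\<And>n. n \<ge> N \<Longrightarrow> rat_padic_abs p (X n) = c"
    using padic_cauchy_not_null[OF assms] by blast
  have nz: "X n \<noteq> 0" if "n \<ge> N" for n
    using c(1) c(2)[OF that] by auto
  have "padic_null p (\<lambda>n. inverse (X n) * X n - 1)"
    unfolding padic_null_def
    by (rule tendsto_eventually, rule eventually_sequentiallyI[of N]) (simp add: nz)
  then show ?thesis
    using assms by (auto simp: padic_rel_def padic_cauchy_const padic_cauchy_mult padic_cauchy_inverse)
qed

lemma padic_rel_inverse: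
  assumes "padic_rel p X Y" and nn: "\<not> padic_null p X"
  shows "padic_rel p (\<lambda>n. inverse (X n)) (\<lambda>n. inverse (Y n))"
proof -
  let ?iX = "\<lambda>n. inverse (X n)" and ?iY = "\<lambda>n. inverse (Y n)"
  have X: "padic_cauchy p X" and Y: "padic_cauchy p Y" using assms by (auto simp: padic_rel_def)
  have nY: "\<not> padic_null p Y" using assms padic_rel_null_iff by blast
  note iX = padic_rel_refl[OF padic_cauchy_inverse[OF X nn]]
  note iY = padic_rel_refl[OF padic_cauchy_inverse[OF Y nY]]
  have 1: "padic_rel p (\<lambda>n. ?iX n * (?iY n * Y n)) (\<lambda>n. ?iX n * 1)"
    by (rule padic_rel_mult[OF iX padic_mult_inverse[OF Y nY]])
  have 2: "padic_rel p (\<lambda>n. ?iY n * (?iX n * X n)) (\<lambda>n. ?iY n * 1)"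
    by (rule padic_rel_mult[OF iY padic_mult_inverse[OF X nn]])
  have 3: "padic_rel p (\<lambda>n. (?iX n * ?iY n) * X n) (\<lambda>n. (?iX n * ?iY n) * Y n)"
    by (rule padic_rel_mult[OF padic_rel_mult[OF iX iY] assms(1)])
  have 4: "(\<lambda>n. ?iY n * (?iX n * X n)) = (\<lambda>n. (?iX n * ?iY n) * X n)"
    "(\<lambda>n. ?iX n * (?iY n * Y n)) = (\<lambda>n. (?iX n * ?iY n) * Y n)"
    by (auto simp: ac_simps)
  have "padic_rel p (\<lambda>n. ?iX n * 1) (\<lambda>n. ?iY n * 1)"
    using padic_rel_trans[OF padic_rel_trans[OF padic_rel_sym[OF 1[unfolded 4]] padic_rel_sym[OF 3]]
        2[unfolded 4]] .
  then show ?thesis by simp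
qed

lemma padic_rel_lim:
  assumes "padic_rel p X Y"
  shows "lim (\<lambda>n. rat_padic_abs p (X n)) = lim (\<lambda>n. rat_padic_abs p (Y n))"
proof -
  obtain l where l: "(\<lambda>n. rat_padic_abs p (X n)) \<longlonglongrightarrow> l"
    using padic_cauchy_abs_Cauchy[of X] assms
    by (auto simp: padic_rel_def Cauchy_convergent_iff convergent_def)
  have "(\<lambda>n. rat_padic_abs p (Y n) - rat_padic_abs p (X n)) \<longlonglongrightarrow> 0"
  proof (rule Lim_null_comparison)
    show "(\<lambda>n. rat_padic_abs p (Y n - X n)) \<longlonglongrightarrow> 0"
      using padic_rel_sym[OF assms] by (simp add: padic_rel_def padic_null_def)
  qed (simp add: rat_padic_abs_diff[OF p])
  from tendsto_add[OF this l] have "(\<lambda>n. rat_padic_abs p (Y n)) \<longlonglongrightarrow> l" by simp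
  with l show ?thesis by (simp add: limI)
qed

end

text \<open>The prime is carried by the type parameter: \<open>'p padic\<close> is the field of \<open>p\<close>-adic numbers
  for \<open>p = CARD('p)\<close>. The command \<open>quotient_type\<close> does not support such phantom parameters,
  so the quotient is set up by hand.\<close>

typedef ('p::prime_card) padic =
  "{C. \<exists>X. padic_cauchy CARD('p) X \<and> C = {Y. padic_rel CARD('p) X Y}}"
  using padic_cauchy_const[OF prime_card] by blast

definition padic_of_seq :: "(nat \<Rightarrow> rat) \<Rightarrow> 'p::prime_card padic" where
  "padic_of_seq X = Abs_padic {Y. padic_rel CARD('p) X Y}"

definition seq_of_padic :: "'p::prime_card padic \<Rightarrow> (nat \<Rightarrow> rat)" where
  "seq_of_padic x = (SOME X. X \<in> Rep_padic x)"

definition cr_padic :: "(nat \<Rightarrow> rat) \<Rightarrow> 'p::prime_card padic \<Rightarrow> bool" where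
  "cr_padic X x \<longleftrightarrow> padic_cauchy CARD('p) X \<and> padic_of_seq X = x"

lemma Quotient_padic:
  "Quotient (padic_rel CARD('p::prime_card)) (padic_of_seq :: _ \<Rightarrow> 'p padic) seq_of_padic cr_padic"
proof -
  let ?R = "padic_rel CARD('p)"
  note refl = padic_rel_refl[where p = "CARD('p)", OF prime_card]
  note sym = padic_rel_sym[where p = "CARD('p)", OF prime_card]
  note trans = padic_rel_trans[where p = "CARD('p)", OF prime_card]
  have cauchy: "?R X X \<longleftrightarrow> padic_cauchy CARD('p) X" for X
    using refl by (auto simp: padic_rel_def)
  have Rep_of_seq: "Rep_padic (padic_of_seq X :: 'p padic) = {Y. ?R X Y}"
    if "padic_cauchy CARD('p) X" for X
    unfolding padic_of_seq_def using that by (intro Abs_padic_inverse) blast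
  have eq_iff: "(padic_of_seq X :: 'p padic) = padic_of_seq Y \<longleftrightarrow> ?R X Y"
    if "padic_cauchy CARD('p) X" "padic_cauchy CARD('p) Y" for X Y
  proof -
    have "(padic_of_seq X :: 'p padic) = padic_of_seq Y \<longleftrightarrow> {Z. ?R X Z} = {Z. ?R Y Z}"
      using that by (simp add: Rep_of_seq flip: Rep_padic_inject)
    also have "\<dots> \<longleftrightarrow> ?R X Y" using that refl sym trans by blast
    finally show ?thesis .
  qed
  have seq: "padic_cauchy CARD('p) (seq_of_padic x) \<and> padic_of_seq (seq_of_padic x) = x"
    for x :: "'p padic"
  proof -
    obtain X where X: "padic_cauchy CARD('p) X" "Rep_padic x = {Y. ?R X Y}"
      using Rep_padic[of x] by blast
    then have "?R X (seq_of_padic x)"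
      unfolding seq_of_padic_def using refl by (metis mem_Collect_eq someI_ex)
    moreover from this have "padic_cauchy CARD('p) (seq_of_padic x)" by (simp add: padic_rel_def)
    moreover have "x = padic_of_seq X"
      using X by (simp add: Rep_of_seq flip: Rep_padic_inject)
    ultimately show ?thesis using X eq_iff by metis
  qed
  show ?thesis
    unfolding Quotient_alt_def cr_padic_def
    using seq eq_iff cauchy by (auto simp: padic_rel_def)
qed

setup_lifting Quotient_padic

instantiation padic :: (prime_card) field
begin

lift_definition zero_padic :: "'a padic" is "\<lambda>_. 0"
  by (simp add: padic_rel_refl padic_cauchy_const prime_card)

lift_definition one_padic :: "'a padic" is "\<lambda>_. 1"
  by (simp add: padic_rel_refl padic_cauchy_const prime_card)

lift_definition plus_padic :: "'a padic \<Rightarrow> 'a padic \<Rightarrow> 'a padic" is "\<lambda>X Y n. X n + Y n"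
  by (rule padic_rel_add[OF prime_card])

lift_definition uminus_padic :: "'a padic \<Rightarrow> 'a padic" is "\<lambda>X n. - X n"
  by (rule padic_rel_minus[OF prime_card])

definition minus_padic :: "'a padic \<Rightarrow> 'a padic \<Rightarrow> 'a padic" where
  "minus_padic x y = x + - y"

lift_definition times_padic :: "'a padic \<Rightarrow> 'a padic \<Rightarrow> 'a padic" is "\<lambda>X Y n. X n * Y n"
  by (rule padic_rel_mult[OF prime_card])

lift_definition inverse_padic :: "'a padic \<Rightarrow> 'a padic"
  is "\<lambda>X. if padic_null CARD('a) X then (\<lambda>_. 0) else (\<lambda>n. inverse (X n))"
  by (auto simp: padic_rel_null_iff[OF prime_card] padic_rel_inverse[OF prime_card]
      padic_rel_refl[OF prime_card] padic_cauchy_const[OF prime_card])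

definition divide_padic :: "'a padic \<Rightarrow> 'a padic \<Rightarrow> 'a padic" where
  "divide_padic x y = x * inverse y"

instance
proof
  note simps = padic_rel_refl[OF prime_card] padic_cauchy_const[OF prime_card]
    padic_cauchy_add[OF prime_card] padic_cauchy_mult[OF prime_card]
    padic_cauchy_minus[OF prime_card]
  fix x y z :: "'a padic"
  show "x + y + z = x + (y + z)"
    by transfer (simp add: padic_rel_def padic_null_def simps add.assoc)
  show "x + y = y + x"
    by transfer (simp add: padic_rel_def padic_null_def simps add.commute)
  show "0 + x = x"
    by transfer (simp add: padic_rel_def padic_null_def simps)
  show "- x + x = 0"
    by transfer (simp add: padic_rel_def padic_null_def simps)
  show "x - y = x + - y" by (simp add: minus_padic_def)
  show "x * y * z = x * (y * z)"
    by transfer (simp add: padic_rel_def padic_null_def simps mult.assoc)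
  show "x * y = y * x"
    by transfer (simp add: padic_rel_def padic_null_def simps mult.commute)
  show "1 * x = x"
    by transfer (simp add: padic_rel_def padic_null_def simps)
  show "(x + y) * z = x * z + y * z"
    by transfer (simp add: padic_rel_def padic_null_def simps distrib_right)
  show "(0 :: 'a padic) \<noteq> 1"
    by transfer (simp add: padic_rel_def padic_null_def prime_card LIMSEQ_const_iff)
  show "x \<noteq> 0 \<Longrightarrow> inverse x * x = 1"
  proof transfer
    fix X :: "nat \<Rightarrow> rat"
    assume *: "padic_rel CARD('a) X X" "\<not> padic_rel CARD('a) X (\<lambda>_. 0)"
    then have "\<not> padic_null CARD('a) X" "padic_cauchy CARD('a) X"
      using simps(2) by (auto simp: padic_rel_def)
    then show "padic_rel CARD('a)
        (\<lambda>n. (if padic_null CARD('a) X then \<lambda>_. 0 else (\<lambda>n. inverse (X n))) n * X n) (\<lambda>_. 1)"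
      using padic_mult_inverse[OF prime_card] by simp
  qed
  show "inverse (0 :: 'a padic) = 0"
    by transfer (simp add: padic_rel_def padic_null_def simps)
  show "x div y = x * inverse y" by (simp add: divide_padic_def)
qed

end

lift_definition padic_of_rat :: "rat \<Rightarrow> 'p::prime_card padic" is "\<lambda>r _. r"
  by (simp add: padic_rel_refl padic_cauchy_const prime_card)

lemma padic_of_rat_simps:
  "padic_of_rat 0 = 0" "padic_of_rat 1 = 1"
  "padic_of_rat (r + s) = padic_of_rat r + padic_of_rat s"
  "padic_of_rat (- r) = - padic_of_rat r"
  "padic_of_rat (r * s) = padic_of_rat r * padic_of_rat s"
  by (transfer, simp add: padic_rel_refl padic_cauchy_const prime_card)+

lemma padic_of_rat_eq_iff [simp]: "padic_of_rat r = padic_of_rat s \<longleftrightarrow> r = s"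
  by transfer
    (simp add: padic_rel_def padic_null_def padic_cauchy_const prime_card LIMSEQ_const_iff)

lemma padic_of_rat_of_nat: "padic_of_rat (of_nat n) = of_nat n"
  by (induction n) (simp_all add: padic_of_rat_simps)

instance padic :: (prime_card) field_char_0
proof
  show "inj (of_nat :: nat \<Rightarrow> 'a padic)"
    by (rule injI) (simp flip: padic_of_rat_of_nat)
qed

lemma padic_of_rat_of_int: "padic_of_rat (of_int k) = of_int k"
  by (cases k rule: int_diff_cases)
     (simp only: of_int_add of_int_minus of_int_of_nat_eq diff_conv_add_uminus padic_of_rat_simps
        padic_of_rat_of_nat)

lemma padic_of_rat: "padic_of_rat r = of_rat r"
proof -
  obtain a b :: int where b: "b > 0" "r = of_int a / of_int b" by (rule rat_frac_cases)
  then have "r * of_int b = of_int a" by simp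
  then have "padic_of_rat r * of_int b = (of_int a :: 'a padic)"
    by (simp flip: padic_of_rat_of_int padic_of_rat_simps(5))
  then have "padic_of_rat r = (of_int a / of_int b :: 'a padic)"
    using b(1) by (simp add: eq_divide_eq)
  then show ?thesis by (simp add: b(2) of_rat_divide)
qed

lift_definition padic_abs :: "'p::prime_card padic \<Rightarrow> real" is
  "\<lambda>X. lim (\<lambda>n. rat_padic_abs CARD('p) (X n))"
  by (rule padic_rel_lim[OF prime_card])

lemma padic_cauchy_tendsto_lim:
  assumes "padic_rel p X X" "prime p"
  shows "(\<lambda>n. rat_padic_abs p (X n)) \<longlonglongrightarrow> lim (\<lambda>n. rat_padic_abs p (X n))"
  using padic_cauchy_abs_Cauchy[of p X] assms
  by (auto simp: padic_rel_def Cauchy_convergent_iff convergent_LIMSEQ_iff)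

lemma padic_abs_nonneg [simp]: "padic_abs x \<ge> 0"
  by transfer
    (rule LIMSEQ_le_const[OF padic_cauchy_tendsto_lim], auto simp: prime_card rat_padic_abs_nonneg)

lemma padic_abs_eq_0 [simp]: "padic_abs x = 0 \<longleftrightarrow> x = 0"
proof transfer
  fix X assume X: "padic_rel CARD('a) X X"
  note lim = padic_cauchy_tendsto_lim[OF X prime_card]
  show "lim (\<lambda>n. rat_padic_abs CARD('a) (X n)) = 0 \<longleftrightarrow> padic_rel CARD('a) X (\<lambda>_. 0)"
    using X lim limI by (auto simp: padic_rel_def padic_null_def padic_cauchy_const[OF prime_card])
qed

lemma padic_abs_0 [simp]: "padic_abs 0 = 0"
  by simp

lemma padic_abs_mult: "padic_abs (x * y) = padic_abs x * padic_abs y"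
proof transfer
  fix X Y assume "padic_rel CARD('a) X X" "padic_rel CARD('a) Y Y"
  then show "lim (\<lambda>n. rat_padic_abs CARD('a) (X n * Y n)) =
      lim (\<lambda>n. rat_padic_abs CARD('a) (X n)) * lim (\<lambda>n. rat_padic_abs CARD('a) (Y n))"
    unfolding rat_padic_abs_mult[OF prime_card]
    by (intro limI tendsto_mult padic_cauchy_tendsto_lim prime_card)
qed

lemma padic_abs_add: "padic_abs (x + y) \<le> max (padic_abs x) (padic_abs y)"
proof transfer
  fix X Y assume *: "padic_rel CARD('a) X X" "padic_rel CARD('a) Y Y"
  show "lim (\<lambda>n. rat_padic_abs CARD('a) (X n + Y n)) \<le>
      max (lim (\<lambda>n. rat_padic_abs CARD('a) (X n))) (lim (\<lambda>n. rat_padic_abs CARD('a) (Y n)))"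
  proof (rule LIMSEQ_le)
    show "(\<lambda>n. rat_padic_abs CARD('a) (X n + Y n)) \<longlonglongrightarrow> lim (\<lambda>n. rat_padic_abs CARD('a) (X n + Y n))"
      by (rule padic_cauchy_tendsto_lim[OF padic_rel_add[OF prime_card *] prime_card])
    show "(\<lambda>n. max (rat_padic_abs CARD('a) (X n)) (rat_padic_abs CARD('a) (Y n))) \<longlonglongrightarrow>
      max (lim (\<lambda>n. rat_padic_abs CARD('a) (X n))) (lim (\<lambda>n. rat_padic_abs CARD('a) (Y n)))"
      using * by (intro tendsto_max padic_cauchy_tendsto_lim prime_card)
  qed (use rat_padic_abs_add[OF prime_card] in blast)
qed

lemma padic_abs_of_rat: "padic_abs (of_rat r :: 'p::prime_card padic) = rat_padic_abs CARD('p) r"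
  unfolding padic_of_rat[symmetric] by transfer simp

lemma padic_abs_1 [simp]: "padic_abs (1 :: 'p::prime_card padic) = 1"
  using padic_abs_of_rat[of 1, where ?'p = 'p] by (simp add: rat_padic_abs_1[OF prime_card])

lemma padic_abs_neg [simp]: "padic_abs (- x) = padic_abs (x :: 'p::prime_card padic)"
proof -
  have "padic_abs (- 1 :: 'p padic) = 1"
    using padic_abs_of_rat[of "- 1", where ?'p = 'p]
    by (simp add: rat_padic_abs_neg[OF prime_card] rat_padic_abs_1[OF prime_card] of_rat_minus)
  then show ?thesis using padic_abs_mult[of "- 1" x] by simp
qed

lemma padic_abs_minus_commute: "padic_abs (x - y) = padic_abs (y - x)"
  using padic_abs_neg[of "x - y"] by simp

lemma padic_abs_diff: "padic_abs (x - y) \<le> max (padic_abs x) (padic_abs y)"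
  using padic_abs_add[of x "- y"] by simp

lemma padic_abs_inverse: "padic_abs (inverse x) = inverse (padic_abs x)"
proof (cases "x = 0")
  case False
  then have "padic_abs x * padic_abs (inverse x) = 1" by (simp flip: padic_abs_mult)
  then show ?thesis by (simp add: inverse_unique)
qed simp

lemma padic_abs_power: "padic_abs (x ^ n) = padic_abs x ^ n"
  by (induction n) (simp_all add: padic_abs_mult)

lemma padic_abs_power_int: "padic_abs (x powi k) = padic_abs x powi k"
  by (simp add: power_int_def padic_abs_power padic_abs_inverse)

lemma padic_abs_p: "padic_abs (of_nat CARD('p) :: 'p::prime_card padic) = inverse (real CARD('p))"
  using padic_abs_of_rat[of "of_nat CARD('p)", where ?'p = 'p]
  by (simp add: rat_padic_abs_p[OF prime_card])

lemma padic_abs_of_int_le_1: "padic_abs (of_int k :: 'p::prime_card padic) \<le> 1"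
  using padic_abs_of_rat[of "of_int k", where ?'p = 'p]
  by (simp add: rat_padic_abs_of_int_le_1[OF prime_card])

lemma padic_abs_of_int_lt_1:
  "padic_abs (of_int k :: 'p::prime_card padic) < 1 \<longleftrightarrow> int CARD('p) dvd k"
  using padic_abs_of_rat[of "of_int k", where ?'p = 'p]
  by (simp add: rat_padic_abs_of_int_lt_1[OF prime_card])

lemma padic_rat_dense:
  fixes x :: "'p::prime_card padic"
  assumes "e > 0"
  obtains r where "padic_abs (x - of_rat r) < e"
proof -
  have "\<exists>r. padic_abs (x + - padic_of_rat r) < e"
  proof (transfer fixing: e)
    fix X :: "nat \<Rightarrow> rat"
    assume X: "padic_rel CARD('p) X X"
    then obtain M where M: "\<And>m n. m \<ge> M \<Longrightarrow> n \<ge> M \<Longrightarrow> rat_padic_abs CARD('p) (X m - X n) < e / 2"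
      using assms unfolding padic_rel_def padic_cauchy_def by (meson half_gt_zero)
    have Y: "padic_rel CARD('p) (\<lambda>n. X n + - X M) (\<lambda>n. X n + - X M)"
      by (rule padic_rel_add[OF prime_card X])
         (simp add: padic_rel_refl padic_cauchy_const prime_card)
    have "rat_padic_abs CARD('p) (X n + - X M) \<le> e / 2" if "n \<ge> M" for n
      using M[OF that order_refl] by simp
    then have "lim (\<lambda>n. rat_padic_abs CARD('p) (X n + - X M)) \<le> e / 2"
      by (intro LIMSEQ_le_const2[OF padic_cauchy_tendsto_lim[OF Y prime_card]]) blast
    then show "\<exists>r. lim (\<lambda>n. rat_padic_abs CARD('p) (X n + - r)) < e"
      using assms by (intro exI[of _ "X M"]) simp
  qed
  then show ?thesis using that by (auto simp: padic_of_rat)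
qed

lemma padic_abs_value:
  fixes x :: "'p::prime_card padic"
  assumes "x \<noteq> 0"
  shows "\<exists>!k. padic_abs x = real CARD('p) powi (- k)"
proof -
  have p1: "real CARD('p) > 1" using prime_gt_1_nat[OF prime_card[where ?'a = 'p]] by simp
  have pos: "padic_abs x > 0" using assms by (simp add: less_le)
  then obtain r where r: "padic_abs (x - of_rat r) < padic_abs x" by (rule padic_rat_dense)
  then have "padic_abs x \<le> padic_abs (of_rat r :: 'p padic)"
    using padic_abs_add[of "x - of_rat r" "of_rat r"] by auto
  moreover have "padic_abs (of_rat r :: 'p padic) \<le> padic_abs x"
    using padic_abs_diff[of x "x - of_rat r"] r by auto
  ultimately have eq: "padic_abs x = rat_padic_abs CARD('p) r" by (simp add: padic_abs_of_rat)
  with pos have "padic_abs x = real CARD('p) powi (- rat_padic_val CARD('p) r)"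
    by (auto simp: rat_padic_abs_def split: if_splits)
  moreover have "k = l"
    if "real CARD('p) powi (- k) = real CARD('p) powi (- l)" for k l :: int
    using that p1 power_int_strict_increasing[of "- k" "- l" "real CARD('p)"]
      power_int_strict_increasing[of "- l" "- k" "real CARD('p)"] by linarith
  ultimately show ?thesis by metis
qed

definition padic_val :: "'p::prime_card padic \<Rightarrow> int extended" where
  "padic_val x = (if x = 0 then Pinf else Fin (THE k. padic_abs x = real CARD('p) powi (- k)))"

lemma padic_abs_eq_val:
  fixes x :: "'p::prime_card padic"
  assumes "x \<noteq> 0"
  shows "padic_val x = Fin k \<longleftrightarrow> padic_abs x = real CARD('p) powi (- k)"
  using padic_abs_value[OF assms] the1_equality[OF padic_abs_value[OF assms]]
    theI'[OF padic_abs_value[OF assms]] assms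
  by (auto simp: padic_val_def)

lemma padic_val_of_rat:
  assumes "r \<noteq> 0"
  shows "padic_val (of_rat r :: 'p::prime_card padic) = Fin (rat_padic_val CARD('p) r)"
  using assms by (simp add: padic_abs_eq_val padic_abs_of_rat rat_padic_abs_def)

instantiation padic :: (prime_card) metric_space
begin

definition dist_padic :: "'a padic \<Rightarrow> 'a padic \<Rightarrow> real" where
  "dist_padic x y = padic_abs (x - y)"

definition uniformity_padic :: "('a padic \<times> 'a padic) filter" where
  "uniformity_padic = (INF e\<in>{0<..}. principal {(x, y). dist x y < e})"

definition open_padic :: "'a padic set \<Rightarrow> bool" where
  "open_padic U \<longleftrightarrow> (\<forall>x\<in>U. eventually (\<lambda>(x', y). x' = x \<longrightarrow> y \<in> U) uniformity)"

instance
proof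
  fix x y z :: "'a padic"
  show "dist x y = 0 \<longleftrightarrow> x = y" by (simp add: dist_padic_def)
  have "padic_abs (x - y) \<le> max (padic_abs (x - z)) (padic_abs (y - z))"
    using padic_abs_diff[of "x - z" "y - z"] by simp
  then show "dist x y \<le> dist x z + dist y z"
    using padic_abs_nonneg[of "x - z"] padic_abs_nonneg[of "y - z"]
    unfolding dist_padic_def by linarith
qed (simp_all add: uniformity_padic_def open_padic_def)

end


section \<open>Browkin expansions and the Browkin s-function\<close>

definition browkin_expansion :: "'p::prime_card padic \<Rightarrow> (int \<Rightarrow> int) \<Rightarrow> bool" where
  "browkin_expansion \<alpha> x \<longleftrightarrow>
     (\<forall>j. 2 * \<bar>x j\<bar> < int CARD('p)) \<and>
     (\<exists>k. (\<forall>j<k. x j = 0) \<and>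
       (\<lambda>n. of_int (x (k + int n)) * of_nat CARD('p) powi (k + int n)) sums \<alpha>)"

lemma browkin_digit_exists:
  fixes x :: "'p::prime_card padic"
  assumes "odd CARD('p)" "padic_abs x \<le> 1"
  shows "\<exists>d. 2 * \<bar>d\<bar> < int CARD('p) \<and> padic_abs (x - of_int d) < 1"
proof -
  let ?p = "int CARD('p)"
  have p: "prime ?p" using prime_card by auto
  obtain r where r: "padic_abs (x - of_rat r) < 1" by (rule padic_rat_dense[of 1 x]) auto
  obtain a b where ab: "quotient_of r = (a, b)" by (cases "quotient_of r")
  have b: "b > 0" "coprime a b" "r = of_int a / of_int b"
    using ab by (auto intro: quotient_of_denom_pos quotient_of_coprime quotient_of_div)
  have ra: "(of_rat r :: 'p padic) * of_int b = of_int a"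
    using b by (simp add: of_rat_divide)
  have "padic_abs (of_rat r :: 'p padic) \<le> 1"
    using padic_abs_diff[of x "x - of_rat r"] r assms by auto
  then have abs_le: "padic_abs (of_int a :: 'p padic) \<le> padic_abs (of_int b :: 'p padic)"
    unfolding ra[symmetric] padic_abs_mult by (intro mult_left_le_one_le) auto
  have nb: "\<not> ?p dvd b"
  proof
    assume "?p dvd b"
    with abs_le have "?p dvd a" by (simp flip: padic_abs_of_int_lt_1[where ?'p = 'p])
    with \<open>?p dvd b\<close> b p show False by (meson coprime_common_divisor not_prime_unit)
  qed
  then have "coprime b ?p" using prime_imp_coprime[OF p nb] by (simp only: coprime_commute)
  then obtain c where c: "[b * c = a] (mod ?p)"
    using cong_solve_coprime_int cong_scalar_right by (metis mult.assoc mult.left_neutral)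
  define h where "h = (?p - 1) div 2"
  define d where "d = (c + h) mod ?p - h"
  have ph: "?p = 2 * h + 1" using assms unfolding h_def by presburger
  have bound: "2 * \<bar>q - h\<bar> < ?p" if "0 \<le> q" "q < ?p" for q using that unfolding ph by arith
  have d: "2 * \<bar>d\<bar> < ?p"
    unfolding d_def using prime_gt_0_int[OF p] by (intro bound) simp_all
  have "[d = c] (mod ?p)"
    using cong_diff[OF cong_mod_left[THEN iffD2, OF cong_refl] cong_refl, of "c + h" ?p h]
    by (simp add: d_def)
  then have "[b * d = a] (mod ?p)" using c cong_scalar_left cong_trans by blast
  then have "?p dvd a - b * d" by (simp add: cong_iff_dvd_diff dvd_diff_commute)
  then have 1: "padic_abs (of_int (a - b * d) :: 'p padic) < 1"
    by (simp only: padic_abs_of_int_lt_1)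
  have "padic_abs (of_int b :: 'p padic) = 1"
    using nb padic_abs_of_int_le_1[of b, where ?'p = 'p] padic_abs_of_int_lt_1[of b, where ?'p = 'p]
    by auto
  moreover have "(of_rat r - of_int d) * of_int b = (of_int (a - b * d) :: 'p padic)"
    using ra by (simp add: algebra_simps)
  ultimately have "padic_abs (of_rat r - of_int d :: 'p padic) < 1"
    using 1 padic_abs_mult[of "of_rat r - of_int d :: 'p padic" "of_int b"] by simp
  then have "padic_abs (x - of_int d) < 1"
    using r padic_abs_add[of "x - of_rat r" "of_rat r - of_int d"] by auto
  with d show ?thesis by blast
qed

lemma padic_abs_lt_1D:
  fixes x :: "'p::prime_card padic"
  assumes "padic_abs x < 1"
  shows "padic_abs x \<le> inverse (real CARD('p))"
proof (cases "x = 0")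
  case False
  have p1: "real CARD('p) > 1" using prime_gt_1_nat[OF prime_card[where ?'a = 'p]] by simp
  obtain k where k: "padic_abs x = real CARD('p) powi (- k)"
    using padic_abs_value[OF False] by blast
  have "k \<ge> 1"
  proof (rule ccontr)
    assume "\<not> k \<ge> 1"
    then have "real CARD('p) powi 0 \<le> real CARD('p) powi (- k)"
      using p1 by (intro power_int_increasing) auto
    with k assms show False by simp
  qed
  then have "real CARD('p) powi (- k) \<le> real CARD('p) powi (- 1)"
    using p1 by (intro power_int_increasing) auto
  with k show ?thesis by (simp add: power_int_minus)
qed simp

lemma browkin_expansion_exists:
  fixes \<alpha> :: "'p::prime_card padic"
  assumes odd: "odd CARD('p)"
  shows "\<exists>x. browkin_expansion \<alpha> x"
proof (cases "\<alpha> = 0")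
  case True
  have "CARD('p) > 0" using prime_gt_0_nat[OF prime_card[where ?'a = 'p]] by simp
  then have "browkin_expansion \<alpha> (\<lambda>_. 0)"
    using True by (auto simp: browkin_expansion_def)
  then show ?thesis by blast
next
  case False
  let ?p = "of_nat CARD('p) :: 'p padic"
  have p1: "real CARD('p) > 1" using prime_gt_1_nat[OF prime_card[where ?'a = 'p]] by simp
  have p0: "?p \<noteq> 0" using p1 by auto
  obtain v where v: "padic_abs \<alpha> = real CARD('p) powi (- v)"
    using padic_abs_value[OF False] by blast
  define dig where "dig = (\<lambda>x :: 'p padic. SOME d. 2 * \<bar>d\<bar> < int CARD('p) \<and> padic_abs (x - of_int d) < 1)"
  have dig: "2 * \<bar>dig x\<bar> < int CARD('p)" "padic_abs (x - of_int (dig x)) < 1"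
    if "padic_abs x \<le> 1" for x
    using someI_ex[OF browkin_digit_exists[OF odd that]] by (auto simp: dig_def)
  define \<beta> where "\<beta> = rec_nat (\<alpha> * ?p powi (- v)) (\<lambda>_ x. (x - of_int (dig x)) / ?p)"
  have \<beta>0: "\<beta> 0 = \<alpha> * ?p powi (- v)" and \<beta>S: "\<beta> (Suc n) = (\<beta> n - of_int (dig (\<beta> n))) / ?p" for n
    by (simp_all add: \<beta>_def)
  have \<beta>_le: "padic_abs (\<beta> n) \<le> 1" for n
  proof (induction n)
    case 0
    have "padic_abs (\<beta> 0) = 1"
      using p1 by (simp add: \<beta>0 padic_abs_mult padic_abs_power_int padic_abs_p v
          power_int_minus power_int_inverse padic_abs_inverse)
    then show ?case by simp
  next
    case (Suc n)
    have "padic_abs (\<beta> (Suc n)) = padic_abs (\<beta> n - of_int (dig (\<beta> n))) * real CARD('p)"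
      by (simp add: \<beta>S divide_inverse padic_abs_mult padic_abs_inverse padic_abs_p)
    also have "\<dots> \<le> inverse (real CARD('p)) * real CARD('p)"
      using padic_abs_lt_1D[OF dig(2)[OF Suc]] by (intro mult_right_mono) auto
    also have "\<dots> = 1" using p1 by simp
    finally show ?case .
  qed
  define x where "x = (\<lambda>j. if j < v then 0 else dig (\<beta> (nat (j - v))))"
  have partial: "\<alpha> - (\<Sum>i<n. of_int (x (v + int i)) * ?p powi (v + int i)) = \<beta> n * ?p powi (v + int n)" for n
  proof (induction n)
    case 0
    then show ?case using p0 by (simp add: \<beta>0 power_int_minus)
  next
    case (Suc n)
    have "?p powi (v + int (Suc n)) = ?p powi (v + int n) * ?p"
      using p0 power_int_add[of ?p "v + int n" 1] by (simp add: add_ac)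
    then have "\<beta> (Suc n) * ?p powi (v + int (Suc n)) = (\<beta> n - of_int (dig (\<beta> n))) * ?p powi (v + int n)"
      using p0 by (simp only: \<beta>S) simp
    also have "\<dots> = \<beta> n * ?p powi (v + int n) - of_int (x (v + int n)) * ?p powi (v + int n)"
      by (simp add: x_def left_diff_distrib)
    finally show ?case unfolding Suc[symmetric] by simp
  qed
  have "(\<lambda>n. padic_abs (\<beta> n * ?p powi (v + int n))) \<longlonglongrightarrow> 0"
  proof (rule Lim_null_comparison)
    have "(\<lambda>n. inverse (real CARD('p)) powi v * inverse (real CARD('p)) ^ n) \<longlonglongrightarrow>
        inverse (real CARD('p)) powi v * 0"
      using p1 by (intro tendsto_mult tendsto_const LIMSEQ_power_zero) (auto simp: inverse_less_1_iff)
    then show "(\<lambda>n. inverse (real CARD('p)) powi v * inverse (real CARD('p)) ^ n) \<longlonglongrightarrow> 0"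
      by simp
    have "padic_abs (\<beta> n * ?p powi (v + int n)) \<le> inverse (real CARD('p)) powi v * inverse (real CARD('p)) ^ n" for n
    proof -
      have "padic_abs (?p powi (v + int n)) = inverse (real CARD('p)) powi v * inverse (real CARD('p)) ^ n"
        unfolding padic_abs_power_int padic_abs_p using p1 by (simp add: power_int_add)
      then show ?thesis
        using \<beta>_le[of n] by (simp add: padic_abs_mult mult_left_le_one_le)
    qed
    then show "\<forall>\<^sub>F n in sequentially. norm (padic_abs (\<beta> n * ?p powi (v + int n))) \<le>
        inverse (real CARD('p)) powi v * inverse (real CARD('p)) ^ n"
      by simp
  qed
  then have "(\<lambda>n. dist (\<Sum>i<n. of_int (x (v + int i)) * ?p powi (v + int i)) \<alpha>) \<longlonglongrightarrow> 0"
    unfolding dist_padic_def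
    by (subst padic_abs_minus_commute) (simp only: partial)
  then have "(\<lambda>n. of_int (x (v + int n)) * ?p powi (v + int n)) sums \<alpha>"
    unfolding sums_def by (subst tendsto_dist_iff)
  moreover have "2 * \<bar>x j\<bar> < int CARD('p)" for j
    using dig(1)[OF \<beta>_le] p1 by (auto simp: x_def)
  ultimately have "browkin_expansion \<alpha> x"
    unfolding browkin_expansion_def by (intro conjI exI[of _ v]) (auto simp: x_def)
  then show ?thesis by blast
qed

lemma padic_abs_sum_le:
  assumes "finite A" "B \<ge> 0" "\<And>i. i \<in> A \<Longrightarrow> padic_abs (f i) \<le> B"
  shows "padic_abs (\<Sum>i\<in>A. f i) \<le> B"
  using assms
proof (induction A rule: finite_induct)
  case (insert a A)
  have "padic_abs (f a) \<le> B" "padic_abs (\<Sum>i\<in>A. f i) \<le> B" using insert by auto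
  then show ?case using insert(1,2) padic_abs_add[of "f a" "\<Sum>i\<in>A. f i"] by auto
qed simp

lemma browkin_expansion_truncate:
  fixes \<alpha> :: "'p::prime_card padic"
  assumes zero: "\<forall>j<k. x j = 0"
    and sums: "(\<lambda>n. of_int (x (k + int n)) * of_nat CARD('p) powi (k + int n)) sums \<alpha>"
    and K: "K \<le> k"
  shows "padic_abs (\<alpha> - (\<Sum>j\<in>{K..<J}. of_int (x j) * of_nat CARD('p) powi j)) \<le> real CARD('p) powi (- J)"
proof -
  define t where "t = (\<lambda>j. of_int (x j) * of_nat CARD('p) powi j :: 'p padic)"
  have p1: "real CARD('p) > 1" using prime_gt_1_nat[OF prime_card[where ?'a = 'p]] by simp
  have t0: "t j = 0" if "j < k" for j using zero that by (simp add: t_def)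
  have t_le: "padic_abs (t j) \<le> real CARD('p) powi (- J)" if "j \<ge> J" for j
  proof -
    have "padic_abs (t j) \<le> real CARD('p) powi (- j)"
      using padic_abs_of_int_le_1[of "x j", where ?'p = 'p]
      by (simp add: t_def padic_abs_mult padic_abs_power_int padic_abs_p power_int_inverse
          power_int_minus mult_left_le_one_le)
    also have "\<dots> \<le> real CARD('p) powi (- J)"
      using p1 that by (intro power_int_increasing) auto
    finally show ?thesis .
  qed
  have partial: "(\<Sum>i<n. t (k + int i)) = (\<Sum>j\<in>{K..<k + int n}. t j)" for n
  proof -
    have "(\<Sum>i<n. t (k + int i)) = (\<Sum>j\<in>{k..<k + int n}. t j)"
      by (rule sum.reindex_bij_witness[of _ "\<lambda>j. nat (j - k)" "\<lambda>i. k + int i"]) auto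
    also have "\<dots> = (\<Sum>j\<in>{K..<k + int n}. t j)"
      using K by (intro sum.mono_neutral_left) (auto simp: t0)
    finally show ?thesis .
  qed
  have "(\<lambda>n. \<Sum>i<n. t (k + int i)) \<longlonglongrightarrow> \<alpha>" using sums by (simp add: sums_def t_def)
  then have "(\<lambda>n. dist (\<Sum>i<n. t (k + int i)) \<alpha>) \<longlonglongrightarrow> 0" by (rule tendsto_dist_iff[THEN iffD1])
  then have "\<forall>\<^sub>F n in sequentially. dist (\<Sum>i<n. t (k + int i)) \<alpha> < real CARD('p) powi (- J)"
    using p1 by (intro order_tendstoD) auto
  moreover have "\<forall>\<^sub>F n in sequentially. n \<ge> nat (J - k)" by (rule eventually_ge_at_top)
  ultimately have "\<forall>\<^sub>F n in sequentially. n \<ge> nat (J - k) \<and>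
      dist (\<Sum>i<n. t (k + int i)) \<alpha> < real CARD('p) powi (- J)"
    by eventually_elim simp
  then obtain n where n: "n \<ge> nat (J - k)"
    "dist (\<Sum>i<n. t (k + int i)) \<alpha> < real CARD('p) powi (- J)"
    using eventually_happens'[OF sequentially_bot] by blast
  have "(\<Sum>j\<in>{K..<k + int n}. t j) = (\<Sum>j\<in>{K..<J}. t j) + (\<Sum>j\<in>{max K J..<k + int n}. t j)"
  proof -
    have "{K..<k + int n} = {K..<J} \<union> {max K J..<k + int n}" using n(1) K by auto
    then show ?thesis by (metis (no_types, lifting) finite_atLeastLessThan_int sum.union_disjoint
        Int_emptyI atLeastLessThan_iff max.bounded_iff not_less)
  qed
  moreover have "padic_abs (\<Sum>j\<in>{max K J..<k + int n}. t j) \<le> real CARD('p) powi (- J)"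
    using t_le by (intro padic_abs_sum_le) auto
  moreover have "padic_abs (\<alpha> - (\<Sum>j\<in>{K..<k + int n}. t j)) \<le> real CARD('p) powi (- J)"
    using n(2) by (simp add: partial dist_padic_def padic_abs_minus_commute)
  ultimately have "padic_abs (\<alpha> - (\<Sum>j\<in>{K..<J}. t j)) \<le> real CARD('p) powi (- J)"
    using padic_abs_add[of "\<alpha> - (\<Sum>j\<in>{K..<k + int n}. t j)" "\<Sum>j\<in>{max K J..<k + int n}. t j"]
    by (auto simp: algebra_simps)
  then show ?thesis by (simp add: t_def)
qed

lemma browkin_expansion_unique:
  fixes \<alpha> :: "'p::prime_card padic"
  assumes "browkin_expansion \<alpha> x" "browkin_expansion \<alpha> y"
  shows "x = y"
proof (rule ccontr)
  let ?p = "of_nat CARD('p) :: 'p padic"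
  assume "x \<noteq> y"
  have p1: "real CARD('p) > 1" using prime_gt_1_nat[OF prime_card[where ?'a = 'p]] by simp
  obtain k where k: "\<forall>j<k. x j = 0" "(\<lambda>n. of_int (x (k + int n)) * ?p powi (k + int n)) sums \<alpha>"
    using assms(1) unfolding browkin_expansion_def by blast
  obtain l where l: "\<forall>j<l. y j = 0" "(\<lambda>n. of_int (y (l + int n)) * ?p powi (l + int n)) sums \<alpha>"
    using assms(2) unfolding browkin_expansion_def by blast
  define K where "K = min k l"
  obtain i where "x i \<noteq> y i" using \<open>x \<noteq> y\<close> by auto
  moreover from this have "i \<ge> K" using k(1)[rule_format, of i] l(1)[rule_format, of i] unfolding K_def by linarith
  ultimately have "\<exists>n. x (K + int n) \<noteq> y (K + int n)" by (intro exI[of _ "nat (i - K)"]) simp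
  then obtain n where n: "x (K + int n) \<noteq> y (K + int n)" "\<And>m. m < n \<Longrightarrow> x (K + int m) = y (K + int m)"
    using exists_least_iff[of "\<lambda>n. x (K + int n) \<noteq> y (K + int n)"] by blast
  define j where "j = K + int n"
  have same: "x i = y i" if "i \<in> {K..<j}" for i
    using n(2)[of "nat (i - K)"] that by (auto simp: j_def)
  define Sx Sy where "Sx = (\<Sum>i\<in>{K..<j + 1}. of_int (x i) * ?p powi i)"
    and "Sy = (\<Sum>i\<in>{K..<j + 1}. of_int (y i) * ?p powi i)"
  have split: "{K..<j + 1} = insert j {K..<j}" by (auto simp: j_def)
  have "Sx - Sy = of_int (x j - y j) * ?p powi j"
  proof -
    have "(\<Sum>i\<in>{K..<j}. of_int (x i) * ?p powi i) = (\<Sum>i\<in>{K..<j}. of_int (y i) * ?p powi i)"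
      using same by (intro sum.cong) auto
    then show ?thesis unfolding Sx_def Sy_def split by (simp add: left_diff_distrib)
  qed
  moreover have "padic_abs (of_int (x j - y j) :: 'p padic) = 1"
  proof -
    have "2 * \<bar>x j\<bar> < int CARD('p)" "2 * \<bar>y j\<bar> < int CARD('p)"
      using assms by (auto simp: browkin_expansion_def)
    then have lt: "\<bar>x j - y j\<bar> < int CARD('p)" by linarith
    have nz: "x j - y j \<noteq> 0" using n(1) by (simp add: j_def)
    have "\<not> int CARD('p) dvd x j - y j"
    proof
      assume "int CARD('p) dvd x j - y j"
      from dvd_imp_le_int[OF nz this] lt show False by simp
    qed
    then show ?thesis
      using padic_abs_of_int_lt_1[of "x j - y j", where ?'p = 'p]
        padic_abs_of_int_le_1[of "x j - y j", where ?'p = 'p] by linarith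
  qed
  ultimately have "padic_abs (Sx - Sy) = real CARD('p) powi (- j)"
    by (simp add: padic_abs_mult padic_abs_power_int padic_abs_p power_int_inverse power_int_minus)
  moreover have "padic_abs (\<alpha> - Sx) \<le> real CARD('p) powi (- (j + 1))"
    unfolding Sx_def by (rule browkin_expansion_truncate[OF k]) (simp add: K_def)
  moreover have "padic_abs (\<alpha> - Sy) \<le> real CARD('p) powi (- (j + 1))"
    unfolding Sy_def by (rule browkin_expansion_truncate[OF l]) (simp add: K_def)
  moreover have "padic_abs (Sx - Sy) \<le> max (padic_abs (\<alpha> - Sy)) (padic_abs (\<alpha> - Sx))"
    using padic_abs_diff[of "\<alpha> - Sy" "\<alpha> - Sx"] by simp
  moreover have "real CARD('p) powi (- (j + 1)) < real CARD('p) powi (- j)"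
    using p1 by (intro power_int_strict_increasing) auto
  ultimately show False by linarith
qed

lemma browkin_expansion_ex1:
  fixes \<alpha> :: "'p::prime_card padic"
  assumes "odd CARD('p)"
  shows "\<exists>!x. browkin_expansion \<alpha> x"
  using browkin_expansion_exists[OF assms] browkin_expansion_unique by blast

definition browkin_digits :: "'p::prime_card padic \<Rightarrow> int \<Rightarrow> int" where
  "browkin_digits \<alpha> = (THE x. browkin_expansion \<alpha> x)"

text \<open>Only finitely many digits at non-positive positions are nonzero, so the sum is finite.\<close>

definition browkin_s :: "'p::prime_card padic \<Rightarrow> 'p padic" where
  "browkin_s \<alpha> =
     (\<Sum>j | j \<le> 0 \<and> browkin_digits \<alpha> j \<noteq> 0.
        of_int (browkin_digits \<alpha> j) * of_nat CARD('p) powi j)"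

lemma finite_browkin_support:
  fixes \<alpha> :: "'p::prime_card padic"
  assumes "odd CARD('p)"
  shows "finite {j. j \<le> 0 \<and> browkin_digits \<alpha> j \<noteq> 0}"
proof -
  have "browkin_expansion \<alpha> (browkin_digits \<alpha>)"
    unfolding browkin_digits_def by (rule theI'[OF browkin_expansion_ex1[OF assms]])
  then obtain k where "\<forall>j<k. browkin_digits \<alpha> j = 0"
    unfolding browkin_expansion_def by blast
  then have "{j. j \<le> 0 \<and> browkin_digits \<alpha> j \<noteq> 0} \<subseteq> {k..0}" by force
  then show ?thesis by (rule finite_subset) simp
qed


section \<open>The p-adic Jacobi--Perron algorithm\<close>

text \<open>Vectors of dimension \<open>m\<close> are functions on \<open>nat\<close> of which only the entries at
  \<open>1, \<dots>, m\<close> are relevant.\<close>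

definition jp_quotient :: "nat \<Rightarrow> (nat \<Rightarrow> 'p::prime_card padic) \<Rightarrow> nat \<Rightarrow> 'p padic" where
  "jp_quotient m \<alpha> i = (if i = m + 1 then 1 else browkin_s (\<alpha> i))"

definition jp_step :: "nat \<Rightarrow> (nat \<Rightarrow> 'p::prime_card padic) \<Rightarrow> nat \<Rightarrow> 'p padic" where
  "jp_step m \<alpha> i =
     (if i = 1 then 1 / (\<alpha> m - jp_quotient m \<alpha> m)
      else (\<alpha> (i - 1) - jp_quotient m \<alpha> (i - 1)) / (\<alpha> m - jp_quotient m \<alpha> m))"

definition jp_halts_at :: "nat \<Rightarrow> (nat \<Rightarrow> 'p::prime_card padic) \<Rightarrow> bool" where
  "jp_halts_at m \<alpha> \<longleftrightarrow> \<alpha> m = jp_quotient m \<alpha> m"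

text \<open>The \<open>n\<close>-th complete quotients, or \<open>None\<close> if the algorithm has stopped before reaching them.\<close>

primrec jp_complete :: "nat \<Rightarrow> (nat \<Rightarrow> 'p::prime_card padic) \<Rightarrow> nat \<Rightarrow> (nat \<Rightarrow> 'p padic) option" where
  "jp_complete m \<alpha> 0 = Some \<alpha>"
| "jp_complete m \<alpha> (Suc n) =
     (case jp_complete m \<alpha> n of
        None \<Rightarrow> None
      | Some \<beta> \<Rightarrow> if jp_halts_at m \<beta> then None else Some (jp_step m \<beta>))"

definition jp_stops :: "nat \<Rightarrow> (nat \<Rightarrow> 'p::prime_card padic) \<Rightarrow> bool" where
  "jp_stops m \<alpha> \<longleftrightarrow> (\<exists>n \<beta>. jp_complete m \<alpha> n = Some \<beta> \<and> jp_halts_at m \<beta>)"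

end

theory Submission
  imports Defs
begin

text \<open>
  Suppose that the algorithm never stops. One step of it is a linear change of variables on the
  vector of complete quotients extended by an entry \<open>1\<close>, so a rational linear relation among the
  entries of \<open>\<alpha>\<close> is carried along by the run. The coefficients of the transported relations are
  consecutive windows of a single rational sequence \<open>s\<close>, which satisfies
  \<open>s (n + m + 1) = (\<Sum>k\<le>m. a k * s (n + k))\<close>, where \<open>a k\<close> is the partial quotient of index
  \<open>m + 1 - k\<close> at time \<open>n\<close>, and the relation at time \<open>n\<close> reads
  \<open>(\<Sum>k\<le>m. s (n + k) * y k) = 0\<close>, where \<open>y k\<close> is the complete quotient of index \<open>m + 1 - k\<close>
  (lemma \<open>jp_relation_step\<close>).

  The sequence \<open>s\<close> is measured in two ways.
  \<^item> The hypothesis on the valuations says that, for large \<open>n\<close>, the entry \<open>y m\<close> dominates the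
    others by \<open>p ^ (m - k) * padic_abs (y k) \<le> padic_abs (y m)\<close> (lemma \<open>jp_step_decay\<close>). Solving
    the relation for \<open>s (n + m)\<close> therefore shows that \<open>p ^ n * padic_abs (s n)\<close> is bounded.
  \<^item> The Browkin digits are smaller than \<open>p / 2\<close> in absolute value, so partial quotients are
    rational numbers of real absolute value at most \<open>p / 2\<close>. After rescaling by \<open>p ^ n\<close> the
    recurrence becomes a contraction with constant
    \<open>p / 2 * (1 / p + 1 / p\<^sup>2 + \<dots>) = p / (2 * (p - 1)) \<le> 3 / 4\<close>, and hence
    \<open>\<bar>s n\<bar> / p ^ n\<close> tends to \<open>0\<close> (lemma \<open>tendsto_0_of_contracting_recurrence\<close>).

  So the product of the real and the \<open>p\<close>-adic absolute value of \<open>s n\<close> tends to \<open>0\<close>. But the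
  partial quotients lie in \<open>\<int>[1/p]\<close>, so away from \<open>p\<close> the denominators of all \<open>s n\<close> divide a
  fixed integer, and for such numbers the product is bounded away from \<open>0\<close> unless they vanish
  (lemma \<open>abs_times_rat_padic_abs_ge\<close>). Thus \<open>s\<close> vanishes eventually. The last coefficient of
  the recurrence is \<open>1\<close>, so the recurrence can be run backwards and \<open>s\<close> vanishes everywhere
  (lemma \<open>recurrence_zero_if_padically_small\<close>). This contradicts the nontriviality of the given
  relation.
\<close>

section \<open>Localising the integers at a prime\<close>

text \<open>The ring \<open>\<int>[1/p]\<close>.\<close>

definition Ints_inverting :: "nat \<Rightarrow> rat set" where
  "Ints_inverting p = {x. \<exists>k. of_nat p ^ k * x \<in> \<int>}"

lemma Ints_subset_Ints_inverting: "x \<in> \<int> \<Longrightarrow> x \<in> Ints_inverting p"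
  unfolding Ints_inverting_def by (auto intro: exI[of _ 0])

lemma Ints_inverting_mult:
  assumes "x \<in> Ints_inverting p" "y \<in> Ints_inverting p"
  shows "x * y \<in> Ints_inverting p"
proof -
  obtain k l where "of_nat p ^ k * x \<in> \<int>" "of_nat p ^ l * y \<in> \<int>"
    using assms unfolding Ints_inverting_def by blast
  then have "(of_nat p ^ k * x) * (of_nat p ^ l * y) \<in> \<int>" by (rule Ints_mult)
  then have "of_nat p ^ (k + l) * (x * y) \<in> \<int>" by (simp add: power_add mult_ac)
  then show ?thesis unfolding Ints_inverting_def by blast
qed

lemma Ints_inverting_add:
  assumes "x \<in> Ints_inverting p" "y \<in> Ints_inverting p"
  shows "x + y \<in> Ints_inverting p"
proof -
  obtain k l where kl: "of_nat p ^ k * x \<in> \<int>" "of_nat p ^ l * y \<in> \<int>"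
    using assms unfolding Ints_inverting_def by blast
  have "of_nat p ^ l * (of_nat p ^ k * x) + of_nat p ^ k * (of_nat p ^ l * y) \<in> \<int>"
    by (intro Ints_add Ints_mult[OF Ints_power] kl) simp_all
  then have "of_nat p ^ (k + l) * (x + y) \<in> \<int>" by (simp add: power_add algebra_simps)
  then show ?thesis unfolding Ints_inverting_def by blast
qed

lemma Ints_inverting_sum:
  assumes "\<And>i. i \<in> A \<Longrightarrow> f i \<in> Ints_inverting p"
  shows "(\<Sum>i\<in>A. f i) \<in> Ints_inverting p"
  using assms
  by (induction A rule: infinite_finite_induct)
     (auto intro: Ints_inverting_add Ints_subset_Ints_inverting)

lemma inverse_power_in_Ints_inverting:
  assumes "p > 0"
  shows "inverse (of_nat p) ^ k \<in> Ints_inverting p"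
proof -
  have "of_nat p ^ k * inverse (of_nat p :: rat) ^ k = 1"
    using assms by (simp flip: power_mult_distrib)
  then show ?thesis unfolding Ints_inverting_def by (auto intro!: exI[of _ k])
qed

lemma common_denominator_exists:
  fixes A :: "rat set"
  assumes "finite A"
  shows "\<exists>D::int. D > 0 \<and> (\<forall>x\<in>A. of_int D * x \<in> \<int>)"
  using assms
proof (induction A rule: finite_induct)
  case empty
  show ?case by (auto intro: exI[of _ 1])
next
  case (insert x A)
  then obtain D where D: "D > 0" "\<And>y. y \<in> A \<Longrightarrow> of_int D * y \<in> \<int>" by blast
  obtain a b where x: "b > 0" "x = of_int a / of_int b" by (rule rat_frac_cases)
  have "of_int (D * b) * y \<in> \<int>" if y: "y \<in> insert x A" for y
  proof (cases "y = x")
    case True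
    have "of_int (D * b) * x = of_int (D * a)" using x by simp
    then show ?thesis using True by (metis Ints_of_int)
  next
    case False
    then have "of_int b * (of_int D * y) \<in> \<int>" using y by (intro Ints_mult D(2)) simp_all
    then show ?thesis by (simp add: mult_ac)
  qed
  then show ?case using D(1) x(1) by (intro exI[of _ "D * b"]) simp
qed

lemma abs_times_rat_padic_abs_of_int_ge_1:
  assumes p: "prime p" and a: "a \<noteq> 0"
  shows "1 \<le> real_of_int \<bar>a\<bar> * rat_padic_abs p (of_int a)"
proof -
  define v where "v = multiplicity (int p) a"
  have p0: "real p > 0" using prime_gt_0_nat[OF p] by simp
  have "int p ^ v dvd \<bar>a\<bar>" by (simp add: v_def multiplicity_dvd)
  then have "int p ^ v \<le> \<bar>a\<bar>" using a by (intro zdvd_imp_le) auto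
  then have "real_of_int (int p ^ v) \<le> real_of_int \<bar>a\<bar>" by (simp only: of_int_le_iff)
  then have "real p ^ v \<le> real_of_int \<bar>a\<bar>" by simp
  moreover have "rat_padic_abs p (of_int a) = inverse (real p ^ v)"
    using a rat_padic_val_frac[OF p a, of 1]
    by (simp add: rat_padic_abs_def v_def power_int_minus)
  ultimately show ?thesis using p0 by (simp add: pos_le_divide_eq flip: divide_inverse)
qed

text \<open>
  A form of the product formula: in \<open>D * x\<close> only \<open>p\<close> can occur in the denominator, so the two
  absolute values that can be small cannot be small simultaneously. Multiplying \<open>x\<close> by a power of
  \<open>p\<close> changes neither the product of the two absolute values nor the assumptions, which reduces the
  claim to integers.
\<close>

lemma abs_times_rat_padic_abs_ge:
  assumes p: "prime p" and D: "D > 0" and x: "of_int D * x \<in> Ints_inverting p" and nz: "x \<noteq> 0"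
  shows "1 \<le> real_of_int D * (\<bar>real_of_rat x\<bar> * rat_padic_abs p x)"
proof -
  have p0: "p > 0" using prime_gt_0_nat[OF p] by simp
  obtain k a where a: "of_nat p ^ k * (of_int D * x) = of_int a"
    using x unfolding Ints_inverting_def Ints_def by blast
  have a0: "a \<noteq> 0" using a nz D p0 by auto
  have "real_of_rat (of_int a) = real p ^ k * (real_of_int D * real_of_rat x)"
    unfolding a[symmetric] by (simp add: of_rat_mult of_rat_power)
  then have arch: "real_of_int \<bar>a\<bar> = real p ^ k * (real_of_int D * \<bar>real_of_rat x\<bar>)"
    using D by (simp add: abs_mult)
  have pow: "rat_padic_abs p (of_nat p ^ k) = inverse (real p ^ k)"
    by (induction k)
       (simp_all add: rat_padic_abs_mult[OF p] rat_padic_abs_p[OF p] rat_padic_abs_1[OF p])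
  have "rat_padic_abs p (of_int a) =
      inverse (real p ^ k) * (rat_padic_abs p (of_int D) * rat_padic_abs p x)"
    unfolding a[symmetric] by (simp add: rat_padic_abs_mult[OF p] pow)
  also have "\<dots> \<le> inverse (real p ^ k) * rat_padic_abs p x"
    using rat_padic_abs_of_int_le_1[OF p, of D] rat_padic_abs_nonneg[OF p]
    by (intro mult_left_mono mult_left_le_one_le) auto
  finally have padic: "rat_padic_abs p (of_int a) \<le> inverse (real p ^ k) * rat_padic_abs p x" .
  have "1 \<le> real_of_int \<bar>a\<bar> * rat_padic_abs p (of_int a)"
    by (rule abs_times_rat_padic_abs_of_int_ge_1[OF p a0])
  also have "\<dots> \<le> real_of_int \<bar>a\<bar> * (inverse (real p ^ k) * rat_padic_abs p x)"
    using padic by (intro mult_left_mono) auto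
  also have "\<dots> = real_of_int D * (\<bar>real_of_rat x\<bar> * rat_padic_abs p x)"
    unfolding arch using p0 by simp
  finally show ?thesis .
qed


section \<open>Linear recurrences\<close>

lemma linear_recurrence_exists:
  fixes init :: "nat \<Rightarrow> 'a::comm_ring_1"
  obtains s where "\<And>k. k \<le> m \<Longrightarrow> s k = init k"
    "\<And>n. s (n + m + 1) = (\<Sum>k\<le>m. b n k * s (n + k))"
proof -
  \<comment> \<open>\<open>c n\<close> is the window of \<open>m + 1\<close> consecutive terms that starts at position \<open>n\<close>.\<close>
  define c where
    "c = rec_nat init (\<lambda>n c k. if k < m then c (Suc k) else \<Sum>j\<le>m. b n j * c j)"
  have c_Suc: "c (Suc n) k = (if k < m then c n (Suc k) else \<Sum>j\<le>m. b n j * c n j)" for n k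
    by (simp add: c_def)
  have shift: "c (n + k) 0 = c n k" if "k \<le> m" for n k
    using that
  proof (induction k arbitrary: n)
    case (Suc k)
    then show ?case using Suc.IH[of "Suc n"] by (simp add: c_Suc)
  qed simp
  show thesis
  proof (rule that[of "\<lambda>n. c n 0"])
    show "c k 0 = init k" if "k \<le> m" for k using shift[OF that, of 0] by (simp add: c_def)
    show "c (n + m + 1) 0 = (\<Sum>k\<le>m. b n k * c (n + k) 0)" for n
    proof -
      have "c (n + m + 1) 0 = c (Suc n) m" using shift[of m "Suc n"] by simp
      also have "\<dots> = (\<Sum>k\<le>m. b n k * c (n + k) 0)" by (simp add: c_Suc shift)
      finally show ?thesis .
    qed
  qed
qed

lemma bounded_of_window_bound:
  fixes u :: "nat \<Rightarrow> real"
  assumes m: "m \<ge> 1"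
    and window: "\<And>n C. n \<ge> N \<Longrightarrow> (\<And>k. k < m \<Longrightarrow> u (n + k) \<le> C) \<Longrightarrow> u (n + m) \<le> C"
  obtains C where "\<And>n. u n \<le> C"
proof -
  define C where "C = Max (u ` {..N + m})"
  have C: "u n \<le> C" if "n \<le> N + m" for n
    unfolding C_def using that by (intro Max_ge) auto
  have "u n \<le> C" for n
  proof (induction n rule: less_induct)
    case (less n)
    show ?case
    proof (cases "n \<le> N + m")
      case False
      then have "u ((n - m) + m) \<le> C" using m by (intro window less.IH) auto
      then show ?thesis using False by simp
    qed (rule C)
  qed
  then show thesis by (rule that)
qed

text \<open>
  The contraction acts only once in \<open>m + 1\<close> steps, so the geometric rate that is preserved by the
  recurrence is the \<open>(m + 1)\<close>-st root of \<open>\<theta>\<close>.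
\<close>

lemma tendsto_0_of_contracting_recurrence:
  fixes t :: "nat \<Rightarrow> real"
  assumes t: "\<And>n. t n \<ge> 0" and w: "\<And>k. w k \<ge> 0" and \<theta>: "0 < \<theta>" "\<theta> < 1"
    and sum_w: "(\<Sum>k\<le>m. w k) \<le> \<theta>"
    and rec: "\<And>n. t (n + m + 1) \<le> (\<Sum>k\<le>m. w k * t (n + k))"
  shows "t \<longlonglongrightarrow> 0"
proof -
  define \<rho> where "\<rho> = root (m + 1) \<theta>"
  have \<rho>: "0 < \<rho>" "\<rho> < 1" and \<rho>_pow: "\<rho> ^ (m + 1) = \<theta>"
    using \<theta> by (auto simp: \<rho>_def simp del: power_Suc)
  define M where "M = Max ((\<lambda>k. t k / \<rho> ^ k) ` {..m})"
  have init: "t k \<le> M * \<rho> ^ k" if "k \<le> m" for k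
  proof -
    have "t k / \<rho> ^ k \<le> M" unfolding M_def using that by (intro Max_ge) auto
    then show ?thesis using \<rho> by (simp add: field_simps)
  qed
  have M: "M \<ge> 0" using init[of 0] t[of 0] by simp
  have bound: "t n \<le> M * \<rho> ^ n" for n
  proof (induction n rule: less_induct)
    case (less n)
    show ?case
    proof (cases "n \<le> m")
      case False
      define i where "i = n - (m + 1)"
      have n: "n = i + m + 1" using False by (simp add: i_def)
      have "t n \<le> (\<Sum>k\<le>m. w k * t (i + k))" unfolding n by (rule rec)
      also have "\<dots> \<le> (\<Sum>k\<le>m. w k * (M * \<rho> ^ i))"
      proof (intro sum_mono mult_left_mono w)
        fix k assume "k \<in> {..m}"
        then have "t (i + k) \<le> M * \<rho> ^ (i + k)" by (intro less.IH) (simp add: n)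
        also have "\<dots> \<le> M * \<rho> ^ i" using \<rho> M by (intro mult_left_mono power_decreasing) auto
        finally show "t (i + k) \<le> M * \<rho> ^ i" .
      qed
      also have "\<dots> = (\<Sum>k\<le>m. w k) * (M * \<rho> ^ i)" by (simp add: sum_distrib_right)
      also have "\<dots> \<le> \<theta> * (M * \<rho> ^ i)" using sum_w M \<rho> by (intro mult_right_mono) auto
      also have "\<dots> = M * \<rho> ^ n" unfolding n \<rho>_pow[symmetric] by (simp add: power_add)
      finally show ?thesis .
    qed (rule init)
  qed
  have "(\<lambda>n. M * \<rho> ^ n) \<longlonglongrightarrow> M * 0"
    using \<rho> by (intro tendsto_mult tendsto_const LIMSEQ_power_zero) auto
  then have "(\<lambda>n. M * \<rho> ^ n) \<longlonglongrightarrow> 0" by simp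
  then show ?thesis by (rule Lim_null_comparison[rotated]) (use t bound in auto)
qed

lemma geometric_sum_bound:
  fixes x :: "'a::linordered_field"
  assumes "x > 0"
  shows "(x - 1) * (\<Sum>i\<le>n. inverse x ^ i) \<le> x"
proof -
  have "(x - 1) * (\<Sum>i\<le>n. inverse x ^ i) = x - inverse x ^ n"
    using assms by (induction n) (simp_all add: field_simps)
  then show ?thesis using assms by simp
qed

text \<open>
  The real absolute value grows more slowly than \<open>p ^ n\<close> by the bound on the coefficients, while
  the \<open>p\<close>-adic one decays like \<open>p ^ (- n)\<close>; a common denominator of the initial window works up
  to powers of \<open>p\<close> for the whole sequence, so the product formula forces the tail to vanish. As the
  oldest term enters with coefficient \<open>1\<close>, zeros propagate backwards. The condition \<open>p \<ge> 3\<close> is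
  what makes \<open>p / (2 * (p - 1))\<close> smaller than \<open>1\<close>.
\<close>

lemma recurrence_zero_if_padically_small:
  fixes s :: "nat \<Rightarrow> rat"
  assumes p: "prime p" "p \<ge> 3"
    and rec: "\<And>n. s (n + m + 1) = (\<Sum>k\<le>m. b n k * s (n + k))"
    and b_ring: "\<And>n k. k \<le> m \<Longrightarrow> b n k \<in> Ints_inverting p"
    and b_abs: "\<And>n k. k \<le> m \<Longrightarrow> \<bar>b n k\<bar> \<le> of_nat p / 2"
    and b_0: "\<And>n. b n 0 = 1"
    and C: "\<And>n. real p ^ n * rat_padic_abs p (s n) \<le> C"
  shows "s n = 0"
proof -
  have p3: "real p \<ge> 3" using p(2) by simp
  define t where "t n = \<bar>real_of_rat (s n)\<bar> * inverse (real p) ^ n" for n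
  define w where "w k = real p / 2 * inverse (real p) ^ (m + 1 - k)" for k
  have t_rec: "t (n + m + 1) \<le> (\<Sum>k\<le>m. w k * t (n + k))" for n
  proof -
    have "\<bar>real_of_rat (s (n + m + 1))\<bar> \<le> (\<Sum>k\<le>m. \<bar>real_of_rat (b n k * s (n + k))\<bar>)"
      unfolding rec of_rat_sum by (rule sum_abs)
    also have "\<dots> \<le> (\<Sum>k\<le>m. real p / 2 * \<bar>real_of_rat (s (n + k))\<bar>)"
    proof (rule sum_mono)
      fix k assume "k \<in> {..m}"
      then have "real_of_rat \<bar>b n k\<bar> \<le> real_of_rat (of_nat p / 2)"
        by (intro of_rat_less_eq[THEN iffD2] b_abs) simp
      then have "\<bar>real_of_rat (b n k)\<bar> \<le> real p / 2"
        by (simp add: of_rat_divide)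
      then show "\<bar>real_of_rat (b n k * s (n + k))\<bar> \<le> real p / 2 * \<bar>real_of_rat (s (n + k))\<bar>"
        unfolding of_rat_mult abs_mult by (intro mult_right_mono) auto
    qed
    finally have "t (n + m + 1) \<le>
        (\<Sum>k\<le>m. real p / 2 * \<bar>real_of_rat (s (n + k))\<bar>) * inverse (real p) ^ (n + m + 1)"
      unfolding t_def by (intro mult_right_mono) auto
    also have "\<dots> = (\<Sum>k\<le>m. w k * t (n + k))"
      unfolding sum_distrib_right
    proof (rule sum.cong)
      fix k assume "k \<in> {..m}"
      then have "n + m + 1 = (m + 1 - k) + (n + k)" by simp
      then have "inverse (real p) ^ (n + m + 1) = inverse (real p) ^ (m + 1 - k) * inverse (real p) ^ (n + k)"
        by (metis power_add)
      then show "real p / 2 * \<bar>real_of_rat (s (n + k))\<bar> * inverse (real p) ^ (n + m + 1) = w k * t (n + k)"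
        by (simp add: w_def t_def del: power_inverse)
    qed simp
    finally show ?thesis .
  qed
  \<comment> \<open>The weights sum to at most \<open>p / (2 * (p - 1))\<close>, which is largest at \<open>p = 3\<close>.\<close>
  have "(\<Sum>k\<le>m. w k) = 1 / 2 * (\<Sum>k\<le>m. inverse (real p) ^ (m - k))"
    unfolding sum_distrib_left
    by (intro sum.cong) (use p3 in \<open>auto simp: w_def Suc_diff_le field_simps\<close>)
  also have "(\<Sum>k\<le>m. inverse (real p) ^ (m - k)) = (\<Sum>k\<le>m. inverse (real p) ^ k)"
    by (rule sum.reindex_bij_witness[of _ "\<lambda>k. m - k" "\<lambda>k. m - k"]) auto
  also have "\<dots> \<le> 3 / 2"
  proof -
    have "(real p - 1) * (\<Sum>k\<le>m. inverse (real p) ^ k) \<le> real p"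
      using p3 by (intro geometric_sum_bound) simp
    also have "\<dots> \<le> (real p - 1) * (3 / 2)" using p3 by simp
    finally show ?thesis by (rule mult_left_le_imp_le) (use p3 in simp)
  qed
  finally have sum_w: "(\<Sum>k\<le>m. w k) \<le> 3 / 4" by simp
  have t_lim: "t \<longlonglongrightarrow> 0"
    by (rule tendsto_0_of_contracting_recurrence[where w = w and \<theta> = "3 / 4" and m = m])
       (use t_rec sum_w in \<open>auto simp: t_def w_def\<close>)

  obtain D where D: "D > 0" "\<And>k. k \<le> m \<Longrightarrow> of_int D * s k \<in> \<int>"
    using common_denominator_exists[of "s ` {..m}"] by auto
  have denom: "of_int D * s n \<in> Ints_inverting p" for n
  proof (induction n rule: less_induct)
    case (less n)
    show ?case
    proof (cases "n \<le> m")
      case True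
      then show ?thesis using D(2) Ints_subset_Ints_inverting by blast
    next
      case False
      define i where "i = n - (m + 1)"
      have n: "n = i + m + 1" using False by (simp add: i_def)
      have "of_int D * s n = (\<Sum>k\<le>m. b i k * (of_int D * s (i + k)))"
        unfolding n rec by (simp add: sum_distrib_left mult_ac)
      also have "\<dots> \<in> Ints_inverting p"
        by (intro Ints_inverting_sum Ints_inverting_mult b_ring less.IH) (auto simp: n)
      finally show ?thesis .
    qed
  qed

  have nonzero_bound: "1 \<le> real_of_int D * C * t n" if "s n \<noteq> 0" for n
  proof -
    have "1 \<le> real_of_int D * (\<bar>real_of_rat (s n)\<bar> * rat_padic_abs p (s n))"
      by (rule abs_times_rat_padic_abs_ge[OF p(1) D(1) denom that])
    also have "\<bar>real_of_rat (s n)\<bar> * rat_padic_abs p (s n) = t n * (real p ^ n * rat_padic_abs p (s n))"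
      using p3 by (simp add: t_def field_simps)
    also have "\<dots> \<le> t n * C" using C by (intro mult_left_mono) (auto simp: t_def)
    finally show ?thesis using D(1) by (simp add: mult_ac)
  qed
  have "(\<lambda>n. real_of_int D * C * t n) \<longlonglongrightarrow> real_of_int D * C * 0"
    by (intro tendsto_mult tendsto_const t_lim)
  then have "\<forall>\<^sub>F n in sequentially. real_of_int D * C * t n < 1"
    by (intro order_tendstoD) auto
  then obtain N where N: "\<And>n. n \<ge> N \<Longrightarrow> real_of_int D * C * t n < 1"
    unfolding eventually_sequentially by blast
  have tail: "s n = 0" if "n \<ge> N" for n using nonzero_bound[of n] N[OF that] by force
  have descend: "s n = 0" if "\<And>i. i > n \<Longrightarrow> s i = 0" for n
  proof -
    have "s (n + m + 1) = (\<Sum>k\<in>{0}. b n k * s (n + k))"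
      unfolding rec by (rule sum.mono_neutral_right) (use that in auto)
    then show ?thesis using that[of "n + m + 1"] b_0 by simp
  qed
  have "\<forall>i\<ge>n. s i = 0"
  proof (cases "n \<le> N")
    case True
    then show ?thesis
    proof (induction n rule: inc_induct)
      case base
      show ?case using tail by blast
    next
      case (step n)
      have "s i = 0" if "i > n" for i using step.IH that by simp
      then show ?case using descend[of n] by (metis le_neq_implies_less)
    qed
  qed (use tail in auto)
  then show ?thesis by simp
qed


section \<open>The Browkin s-function\<close>

text \<open>
  Both parts come from rewriting \<open>browkin_s \<alpha>\<close> as the sum over an interval of positions that ends
  at \<open>0\<close>. The bound on the real absolute value is the geometric series with digits at most
  \<open>(p - 1) / 2\<close>.
\<close>

lemma browkin_s_properties:
  fixes \<alpha> :: "'p::prime_card padic"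
  assumes "odd CARD('p)"
  shows "padic_abs (\<alpha> - browkin_s \<alpha>) \<le> inverse (real CARD('p))"
    and "\<exists>r. browkin_s \<alpha> = of_rat r \<and> r \<in> Ints_inverting CARD('p) \<and> \<bar>r\<bar> \<le> of_nat CARD('p) / 2"
proof -
  define x where "x = browkin_digits \<alpha>"
  have exp: "browkin_expansion \<alpha> x"
    unfolding x_def browkin_digits_def by (rule theI'[OF browkin_expansion_ex1[OF assms]])
  have p0: "CARD('p) > 0" using prime_gt_0_nat[OF prime_card[where ?'a = 'p]] by simp
  obtain k where k: "\<forall>j<k. x j = 0"
    "(\<lambda>n. of_int (x (k + int n)) * of_nat CARD('p) powi (k + int n)) sums \<alpha>"
    using exp unfolding browkin_expansion_def by blast
  have digit: "2 * \<bar>x j\<bar> \<le> int CARD('p) - 1" for j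
    using exp unfolding browkin_expansion_def by (smt (verit))
  define K where "K = min k 0"
  have s: "browkin_s \<alpha> = (\<Sum>j\<in>{K..<1}. of_int (x j) * of_nat CARD('p) powi j)"
    unfolding browkin_s_def x_def[symmetric]
  proof (rule sum.mono_neutral_left)
    have "\<not> j < k" if "x j \<noteq> 0" for j using k(1) that by blast
    then show "{j. j \<le> 0 \<and> x j \<noteq> 0} \<subseteq> {K..<1}" by (force simp: K_def)
  qed auto
  show "padic_abs (\<alpha> - browkin_s \<alpha>) \<le> inverse (real CARD('p))"
    using browkin_expansion_truncate[OF k, of K 1] unfolding s by (simp add: K_def power_int_minus)
  define n where "n = nat (- K)"
  define r :: rat where "r = (\<Sum>i\<le>n. of_int (x (- int i)) * inverse (of_nat CARD('p)) ^ i)"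
  have "browkin_s \<alpha> = (\<Sum>i\<le>n. of_int (x (- int i)) * of_nat CARD('p) powi (- int i))"
    unfolding s by (rule sum.reindex_bij_witness[of _ "\<lambda>i. - int i" "\<lambda>j. nat (- j)"])
      (auto simp: n_def K_def)
  also have "\<dots> = of_rat r"
    by (simp add: r_def of_rat_sum of_rat_mult of_rat_power of_rat_inverse power_int_minus power_inverse)
  finally have "browkin_s \<alpha> = of_rat r" .
  moreover have "r \<in> Ints_inverting CARD('p)"
    unfolding r_def
    by (intro Ints_inverting_sum Ints_inverting_mult inverse_power_in_Ints_inverting p0
        Ints_subset_Ints_inverting Ints_of_int)
  moreover have "\<bar>r\<bar> \<le> of_nat CARD('p) / 2"
  proof -
    have "\<bar>r\<bar> \<le> (\<Sum>i\<le>n. \<bar>of_int (x (- int i)) * inverse (of_nat CARD('p)) ^ i\<bar>)"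
      unfolding r_def by (rule sum_abs)
    also have "\<dots> \<le> (\<Sum>i\<le>n. (of_nat CARD('p) - 1) / 2 * inverse (of_nat CARD('p)) ^ i)"
    proof (rule sum_mono)
      fix i
      have "(of_int (2 * \<bar>x (- int i)\<bar>) :: rat) \<le> of_int (int CARD('p) - 1)"
        using digit by (simp only: of_int_le_iff)
      then have "\<bar>of_int (x (- int i)) :: rat\<bar> \<le> (of_nat CARD('p) - 1) / 2" by simp
      then have "\<bar>of_int (x (- int i)) :: rat\<bar> * inverse (of_nat CARD('p)) ^ i
          \<le> (of_nat CARD('p) - 1) / 2 * inverse (of_nat CARD('p)) ^ i"
        by (rule mult_right_mono) simp
      then show "\<bar>of_int (x (- int i)) * inverse (of_nat CARD('p)) ^ i :: rat\<bar>
          \<le> (of_nat CARD('p) - 1) / 2 * inverse (of_nat CARD('p)) ^ i"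
        by (simp add: abs_mult)
    qed
    also have "\<dots> = (of_nat CARD('p) - 1) * (\<Sum>i\<le>n. inverse (of_nat CARD('p)) ^ i) / 2"
      by (simp add: sum_distrib_left sum_divide_distrib)
    also have "\<dots> \<le> of_nat CARD('p) / 2"
      using p0 by (intro divide_right_mono geometric_sum_bound) auto
    finally show ?thesis .
  qed
  ultimately show "\<exists>r. browkin_s \<alpha> = of_rat r \<and> r \<in> Ints_inverting CARD('p) \<and>
      \<bar>r\<bar> \<le> of_nat CARD('p) / 2" by blast
qed

lemma padic_abs_le_of_val_diff:
  fixes x y :: "'p::prime_card padic"
  assumes y: "y \<noteq> 0" and val: "padic_val x - padic_val y \<ge> Fin (int d)"
  shows "real CARD('p) ^ d * padic_abs x \<le> padic_abs y"
proof (cases "x = 0")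
  case False
  have p1: "real CARD('p) > 1" using prime_gt_1_nat[OF prime_card[where ?'a = 'p]] by simp
  obtain k l where kl: "padic_abs x = real CARD('p) powi (- k)" "padic_abs y = real CARD('p) powi (- l)"
    using padic_abs_value[OF False] padic_abs_value[OF y] by blast
  then have "padic_val x = Fin k" "padic_val y = Fin l"
    using padic_abs_eq_val[OF False] padic_abs_eq_val[OF y] by auto
  then have "int d \<le> k - l" using val by simp
  then have "real CARD('p) powi (int d + - k) \<le> real CARD('p) powi (- l)"
    using p1 by (intro power_int_increasing) auto
  moreover have "real CARD('p) powi (int d + - k) = real CARD('p) ^ d * real CARD('p) powi (- k)"
    using p1 by (subst power_int_add) auto
  ultimately show ?thesis by (simp only: kl)
qed simp


section \<open>The Jacobi--Perron algorithm\<close>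

text \<open>
  Homogeneous coordinates: with the conventional last entry \<open>1\<close>, a step of the algorithm is a
  linear map up to scaling.
\<close>

definition jp_extend :: "nat \<Rightarrow> (nat \<Rightarrow> 'p::prime_card padic) \<Rightarrow> nat \<Rightarrow> 'p padic" where
  "jp_extend m \<alpha> i = (if i = m + 1 then 1 else \<alpha> i)"

lemma jp_complete_eq_iterate:
  assumes "\<not> jp_stops m \<alpha>"
  shows "jp_complete m \<alpha> n = Some ((jp_step m ^^ n) \<alpha>)"
    and "\<not> jp_halts_at m ((jp_step m ^^ n) \<alpha>)"
proof -
  show complete: "jp_complete m \<alpha> n = Some ((jp_step m ^^ n) \<alpha>)"
  proof (induction n)
    case (Suc n)
    then have "\<not> jp_halts_at m ((jp_step m ^^ n) \<alpha>)" using assms unfolding jp_stops_def by blast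
    then show ?case using Suc by simp
  qed simp
  then show "\<not> jp_halts_at m ((jp_step m ^^ n) \<alpha>)" using assms unfolding jp_stops_def by blast
qed

text \<open>
  This is the definition of the step with its denominator cleared. For \<open>i = m\<close> it says that the
  conventional entry \<open>1\<close> is the quotient of \<open>\<alpha> m - jp_quotient m \<alpha> m\<close> by itself.
\<close>

lemma jp_extend_step:
  assumes m: "m \<ge> 1" and "\<not> jp_halts_at m \<alpha>" and i: "i \<in> {1..m}"
  shows "(jp_extend m \<alpha> i - jp_quotient m \<alpha> i) * jp_extend m (jp_step m \<alpha>) 1 =
    jp_extend m (jp_step m \<alpha>) (Suc i)"
  using assms by (auto simp: jp_extend_def jp_step_def jp_halts_at_def)

lemma jp_quotient_properties:
  fixes \<alpha> :: "nat \<Rightarrow> 'p::prime_card padic"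
  assumes "odd CARD('p)"
  shows "padic_abs (jp_extend m \<alpha> i - jp_quotient m \<alpha> i) \<le> inverse (real CARD('p))"
    and "\<exists>r. jp_quotient m \<alpha> i = of_rat r \<and> r \<in> Ints_inverting CARD('p) \<and> \<bar>r\<bar> \<le> of_nat CARD('p) / 2"
proof -
  have p2: "CARD('p) \<ge> 2" using prime_ge_2_nat[OF prime_card[where ?'a = 'p]] .
  show "padic_abs (jp_extend m \<alpha> i - jp_quotient m \<alpha> i) \<le> inverse (real CARD('p))"
    using browkin_s_properties(1)[OF assms] by (simp add: jp_extend_def jp_quotient_def)
  have "(1::rat) \<le> of_nat CARD('p) / 2" using p2 by simp
  then show "\<exists>r. jp_quotient m \<alpha> i = of_rat r \<and> r \<in> Ints_inverting CARD('p) \<and> \<bar>r\<bar> \<le> of_nat CARD('p) / 2"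
    using browkin_s_properties(2)[OF assms, of "\<alpha> i"]
    by (cases "i = m + 1")
       (auto simp: jp_quotient_def Ints_subset_Ints_inverting intro!: exI[of _ 1])
qed

lemma jp_step_dominant:
  fixes \<alpha> :: "nat \<Rightarrow> 'p::prime_card padic"
  assumes "odd CARD('p)" and m: "m \<ge> 1" and run: "\<not> jp_halts_at m \<alpha>"
  shows "padic_abs (jp_step m \<alpha> 1) \<ge> real CARD('p)"
    and "i \<in> {1..m} \<Longrightarrow> real CARD('p) * padic_abs (jp_extend m (jp_step m \<alpha>) (Suc i)) \<le>
      padic_abs (jp_step m \<alpha> 1)"
proof -
  have p0: "real CARD('p) > 0" using prime_gt_0_nat[OF prime_card[where ?'a = 'p]] by simp
  have ext1: "jp_extend m (jp_step m \<alpha>) 1 = jp_step m \<alpha> 1" using m by (simp add: jp_extend_def)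
  show le: "real CARD('p) * padic_abs (jp_extend m (jp_step m \<alpha>) (Suc i)) \<le>
      padic_abs (jp_step m \<alpha> 1)" if i: "i \<in> {1..m}" for i
  proof -
    have "padic_abs (jp_extend m (jp_step m \<alpha>) (Suc i)) =
        padic_abs (jp_extend m \<alpha> i - jp_quotient m \<alpha> i) * padic_abs (jp_step m \<alpha> 1)"
      using jp_extend_step[OF m run i] unfolding ext1 by (simp only: flip: padic_abs_mult)
    also have "\<dots> \<le> inverse (real CARD('p)) * padic_abs (jp_step m \<alpha> 1)"
      by (intro mult_right_mono jp_quotient_properties assms) simp
    finally show ?thesis using p0 by (simp add: field_simps)
  qed
  show "padic_abs (jp_step m \<alpha> 1) \<ge> real CARD('p)"
    using le[of m] m by (simp add: jp_extend_def)
qed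

text \<open>
  The assumption on partial quotients is transferred to complete quotients. The two differ by at
  most \<open>1 / p\<close>, which matters when a partial quotient is \<open>0\<close> and the valuation of the complete
  quotient is not determined by it. For \<open>m \<ge> 2\<close> the case \<open>j = m + 1\<close> of the assumption helps: the partial
  quotient of that index is \<open>1\<close>, so the first one has absolute value at least \<open>p ^ m\<close>, and the
  discrepancy \<open>1 / p\<close> is harmless for every index. The index \<open>2\<close>, which the assumption leaves
  out, is covered by \<open>jp_step_dominant\<close>.
\<close>

lemma jp_step_decay:
  fixes \<alpha> :: "nat \<Rightarrow> 'p::prime_card padic"
  assumes odd: "odd CARD('p)" and m: "m \<ge> 1" and run: "\<not> jp_halts_at m \<alpha>"
    and val: "\<forall>j\<in>{3..m+1}. padic_val (jp_quotient m (jp_step m \<alpha>) j) -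
        padic_val (jp_quotient m (jp_step m \<alpha>) 1) \<ge> Fin (int j - 1)"
    and i: "i \<in> {1..m}"
  shows "real CARD('p) ^ i * padic_abs (jp_extend m (jp_step m \<alpha>) (Suc i)) \<le>
    padic_abs (jp_step m \<alpha> 1)"
proof (cases "i = 1")
  case True
  then show ?thesis using jp_step_dominant(2)[OF odd m run, of 1] m by simp
next
  case False
  let ?p = "real CARD('p)"
  define \<beta> where "\<beta> = jp_step m \<alpha>"
  have p1: "?p > 1" using prime_gt_1_nat[OF prime_card[where ?'a = 'p]] by simp
  have big: "padic_abs (\<beta> 1) \<ge> ?p"
    unfolding \<beta>_def by (rule jp_step_dominant[OF odd m run])
  have close: "padic_abs (jp_extend m \<beta> j - jp_quotient m \<beta> j) \<le> inverse ?p" for j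
    by (rule jp_quotient_properties[OF odd])
  have inv: "inverse ?p < 1" using p1 by (simp add: inverse_less_1_iff)
  have ext1: "jp_extend m \<beta> 1 = \<beta> 1" using m by (simp add: jp_extend_def)
  have a1_nz: "jp_quotient m \<beta> 1 \<noteq> 0" using close[of 1] big p1 inv unfolding ext1 by force
  have a1_le: "padic_abs (jp_quotient m \<beta> 1) \<le> padic_abs (\<beta> 1)"
    using padic_abs_diff[of "\<beta> 1" "\<beta> 1 - jp_quotient m \<beta> 1"] close[of 1] big p1 inv
    unfolding ext1 by auto
  have quot: "?p ^ d * padic_abs (jp_quotient m \<beta> (Suc d)) \<le> padic_abs (jp_quotient m \<beta> 1)"
    if "d \<in> {2..m}" for d
    using val[rule_format, of "Suc d"] that a1_nz
    by (intro padic_abs_le_of_val_diff) (auto simp: \<beta>_def)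
  have i2: "i \<in> {2..m}" using i False by auto
  have "?p ^ m \<le> padic_abs (jp_quotient m \<beta> 1)"
    using quot[of m] i2 by (simp add: jp_quotient_def)
  have "?p ^ i * inverse ?p \<le> ?p ^ m * 1"
    using p1 inv i2 by (intro mult_mono power_increasing) auto
  also have "\<dots> \<le> padic_abs (jp_quotient m \<beta> 1)" using \<open>?p ^ m \<le> _\<close> by simp
  finally have small: "?p ^ i * inverse ?p \<le> padic_abs (jp_quotient m \<beta> 1)" .
  have "padic_abs (jp_extend m \<beta> (Suc i)) \<le> max (inverse ?p) (padic_abs (jp_quotient m \<beta> (Suc i)))"
    using padic_abs_add[of "jp_extend m \<beta> (Suc i) - jp_quotient m \<beta> (Suc i)" "jp_quotient m \<beta> (Suc i)"]
      close[of "Suc i"] by auto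
  then have "?p ^ i * padic_abs (jp_extend m \<beta> (Suc i)) \<le>
      ?p ^ i * max (inverse ?p) (padic_abs (jp_quotient m \<beta> (Suc i)))"
    using p1 by (intro mult_left_mono) auto
  also have "\<dots> \<le> padic_abs (jp_quotient m \<beta> 1)"
    using small quot[OF i2] by (auto simp: max_def)
  finally show ?thesis using a1_le unfolding \<beta>_def by simp
qed

text \<open>
  By \<open>jp_extend_step\<close>, the new relation is the old one multiplied by the first new complete
  quotient. The list of coefficients is indexed against the entries, so that the step shifts it by
  one and appends \<open>c' m\<close>.
\<close>

lemma jp_relation_step:
  assumes m: "m \<ge> 1" and run: "\<not> jp_halts_at m \<alpha>"
    and rel: "(\<Sum>k\<le>m. c k * jp_extend m \<alpha> (m + 1 - k)) = 0"
    and shift: "\<And>k. k < m \<Longrightarrow> c' k = c (Suc k)"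
    and new: "c' m = (\<Sum>k\<le>m. c k * jp_quotient m \<alpha> (m + 1 - k))"
  shows "(\<Sum>k\<le>m. c' k * jp_extend m (jp_step m \<alpha>) (m + 1 - k)) = 0"
proof -
  define z where "z = jp_extend m (jp_step m \<alpha>) 1"
  define d where "d k = jp_extend m \<alpha> (m + 1 - k) - jp_quotient m \<alpha> (m + 1 - k)" for k
  have d0: "d 0 = 0" by (simp add: d_def jp_extend_def jp_quotient_def)
  have dS: "jp_extend m (jp_step m \<alpha>) (m + 1 - k) = d (Suc k) * z" if "k < m" for k
    using jp_extend_step[OF m run, of "m - k"] that by (simp add: d_def z_def Suc_diff_le)
  have "(\<Sum>k\<le>m. c' k * jp_extend m (jp_step m \<alpha>) (m + 1 - k)) =
      (\<Sum>k<m. c' k * jp_extend m (jp_step m \<alpha>) (m + 1 - k)) + c' m * z"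
    by (simp add: z_def flip: lessThan_Suc_atMost)
  also have "(\<Sum>k<m. c' k * jp_extend m (jp_step m \<alpha>) (m + 1 - k)) = (\<Sum>k<m. c (Suc k) * d (Suc k)) * z"
    unfolding sum_distrib_right by (intro sum.cong) (simp_all only: lessThan_iff dS shift mult.assoc)
  also have "(\<Sum>k<m. c (Suc k) * d (Suc k)) = (\<Sum>k\<le>m. c k * d k)"
    by (simp add: sum.atMost_shift d0)
  also have "(\<Sum>k\<le>m. c k * d k) * z + c' m * z = (\<Sum>k\<le>m. c k * jp_extend m \<alpha> (m + 1 - k)) * z"
    unfolding new d_def by (simp add: algebra_simps sum_subtractf)
  finally show ?thesis using rel by simp
qed


section \<open>Finiteness\<close>

theorem theorem1:
  fixes m :: nat
    and \<alpha> :: "nat \<Rightarrow> 'p::prime_card padic"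
  assumes p_odd: "odd CARD('p)"
    and m: "m \<ge> 1"
    and dependent: "\<exists>c :: nat \<Rightarrow> rat. (\<exists>i\<le>m. c i \<noteq> 0) \<and>
          of_rat (c 0) + (\<Sum>i=1..m. of_rat (c i) * \<alpha> i) = 0"
    and valuations: "\<exists>N. \<forall>n\<ge>N. \<forall>\<beta>. jp_complete m \<alpha> n = Some \<beta> \<longrightarrow>
          (\<forall>j\<in>{3..m+1}. padic_val (jp_quotient m \<beta> j) - padic_val (jp_quotient m \<beta> 1)
              \<ge> Fin (int j - 1))"
  shows "jp_stops m \<alpha>"
proof (rule ccontr)
  assume nonstop: "\<not> jp_stops m \<alpha>"
  let ?p = "real CARD('p)"
  define \<beta> where "\<beta> n = (jp_step m ^^ n) \<alpha>" for n
  have \<beta>_Suc: "\<beta> (Suc n) = jp_step m (\<beta> n)" for n by (simp add: \<beta>_def)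
  have run: "\<not> jp_halts_at m (\<beta> n)" for n
    unfolding \<beta>_def by (rule jp_complete_eq_iterate[OF nonstop])
  have p: "prime CARD('p)" "CARD('p) \<ge> 3"
  proof -
    have "CARD('p) \<noteq> 2" using p_odd by auto
    then show "CARD('p) \<ge> 3" using prime_ge_2_nat[OF prime_card[where ?'a = 'p]] by linarith
  qed (rule prime_card)
  have p1: "?p > 1" using p by simp
  obtain c :: "nat \<Rightarrow> rat" where c: "\<exists>i\<le>m. c i \<noteq> 0"
    "of_rat (c 0) + (\<Sum>i=1..m. of_rat (c i) * \<alpha> i) = 0"
    using dependent by blast
  obtain N where N: "\<And>n. n \<ge> N \<Longrightarrow> \<forall>j\<in>{3..m+1}. padic_val (jp_quotient m (\<beta> n) j) -
      padic_val (jp_quotient m (\<beta> n) 1) \<ge> Fin (int j - 1)"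
    using valuations jp_complete_eq_iterate(1)[OF nonstop] unfolding \<beta>_def by blast

  \<comment> \<open>The entry \<open>1\<close> has index \<open>0\<close> in \<open>c\<close> but index \<open>m + 1\<close> in the algorithm.\<close>
  define init where "init k = (if k = 0 then c 0 else c (m + 1 - k))" for k
  obtain b where b: "\<And>n k. jp_quotient m (\<beta> n) (m + 1 - k) = of_rat (b n k)"
    "\<And>n k. b n k \<in> Ints_inverting CARD('p)" "\<And>n k. \<bar>b n k\<bar> \<le> of_nat CARD('p) / 2"
  proof -
    have "\<forall>n k. \<exists>r. jp_quotient m (\<beta> n) (m + 1 - k) = of_rat r \<and> r \<in> Ints_inverting CARD('p) \<and>
        \<bar>r\<bar> \<le> of_nat CARD('p) / 2"
      using jp_quotient_properties(2)[OF p_odd] by blast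
    then show thesis using that by metis
  qed
  obtain s where s: "\<And>k. k \<le> m \<Longrightarrow> s k = init k"
    "\<And>n. s (n + m + 1) = (\<Sum>k\<le>m. b n k * s (n + k))"
    using linear_recurrence_exists[of m init b] by blast

  have relation: "(\<Sum>k\<le>m. of_rat (s (n + k)) * jp_extend m (\<beta> n) (m + 1 - k)) = 0" for n
  proof (induction n)
    case 0
    have "(\<Sum>k\<le>m. of_rat (s k) * jp_extend m \<alpha> (m + 1 - k)) =
        (\<Sum>k\<in>insert 0 {1..m}. of_rat (s k) * jp_extend m \<alpha> (m + 1 - k))"
      by (intro sum.cong) auto
    also have "\<dots> = of_rat (c 0) + (\<Sum>k=1..m. of_rat (c (m + 1 - k)) * \<alpha> (m + 1 - k))"
      by (subst sum.insert) (auto simp: s init_def jp_extend_def intro!: sum.cong)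
    also have "(\<Sum>k=1..m. of_rat (c (m + 1 - k)) * \<alpha> (m + 1 - k)) = (\<Sum>i=1..m. of_rat (c i) * \<alpha> i)"
      by (rule sum.reindex_bij_witness[of _ "\<lambda>i. m + 1 - i" "\<lambda>k. m + 1 - k"]) auto
    finally show ?case using c(2) by (simp add: \<beta>_def)
  next
    case (Suc n)
    show ?case
      unfolding \<beta>_Suc
    proof (rule jp_relation_step[OF m run Suc.IH])
      have "s (Suc n + m) = (\<Sum>k\<le>m. b n k * s (n + k))" using s(2)[of n] by simp
      then show "of_rat (s (Suc n + m)) =
          (\<Sum>k\<le>m. of_rat (s (n + k)) * jp_quotient m (\<beta> n) (m + 1 - k))"
        by (simp only: b(1) of_rat_sum of_rat_mult mult.commute)
    qed simp
  qed

  define u where "u n = ?p ^ n * padic_abs (of_rat (s n) :: 'p padic)" for n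
  \<comment> \<open>From time \<open>Suc N\<close> on, the complete quotients result from a step, so that the first one is large,
    and satisfy the assumption on valuations.\<close>
  have window: "u (n + m) \<le> C" if n: "n \<ge> Suc N" and C: "\<And>k. k < m \<Longrightarrow> u (n + k) \<le> C" for n C
  proof -
    let ?y = "\<lambda>k. jp_extend m (\<beta> n) (m + 1 - k)"
    obtain n' where n': "n = Suc n'" "n' \<ge> N" using n by (cases n) auto
    have ym: "?y m = \<beta> n 1" using m by (simp add: jp_extend_def)
    have "padic_abs (\<beta> n 1) \<ge> ?p"
      unfolding n' \<beta>_Suc by (rule jp_step_dominant[OF p_odd m run])
    then have pos: "padic_abs (?y m) > 0" unfolding ym using p1 by linarith
    have decay: "?p ^ (m - k) * padic_abs (?y k) \<le> padic_abs (?y m)" if "k < m" for k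
      using jp_step_decay[OF p_odd m run[of n'] N[of n, unfolded n' \<beta>_Suc], of "m - k"] n' that
      unfolding ym by (simp add: \<beta>_Suc Suc_diff_le)
    have "u n \<ge> 0" using p1 by (simp add: u_def)
    then have C0: "C \<ge> 0" using C[of 0] m by simp
    have "(\<Sum>k<m. of_rat (s (n + k)) * ?y k) + of_rat (s (n + m)) * ?y m = 0"
      using relation[of n] by (simp flip: lessThan_Suc_atMost)
    then have "of_rat (s (n + m)) * ?y m = - (\<Sum>k<m. of_rat (s (n + k)) * ?y k)"
      by (simp only: eq_neg_iff_add_eq_0 add.commute)
    then have "padic_abs (of_rat (s (n + m)) * ?y m) = padic_abs (\<Sum>k<m. of_rat (s (n + k)) * ?y k)"
      by simp
    also have "\<dots> \<le> C * inverse (?p ^ (n + m)) * padic_abs (?y m)"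
    proof (rule padic_abs_sum_le)
      fix k assume "k \<in> {..<m}"
      then have k: "k < m" by simp
      have "u (n + k) * (?p ^ (m - k) * padic_abs (?y k)) \<le> C * padic_abs (?y m)"
        using C[OF k] decay[OF k] C0 p1 by (intro mult_mono) auto
      moreover have "?p ^ (n + m) = ?p ^ (n + k) * ?p ^ (m - k)"
        using k by (simp flip: power_add)
      ultimately have "?p ^ (n + m) * (padic_abs (of_rat (s (n + k)) :: 'p padic) * padic_abs (?y k))
          \<le> C * padic_abs (?y m)"
        by (simp add: u_def mult_ac)
      then show "padic_abs (of_rat (s (n + k)) * ?y k) \<le> C * inverse (?p ^ (n + m)) * padic_abs (?y m)"
        using p1 by (simp add: padic_abs_mult field_simps)
    qed (use C0 in auto)
    finally have "padic_abs (of_rat (s (n + m)) :: 'p padic) \<le> C * inverse (?p ^ (n + m))"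
      using pos by (simp add: padic_abs_mult)
    then show ?thesis using p1 by (simp add: u_def field_simps)
  qed
  obtain C where "\<And>n. u n \<le> C"
    using bounded_of_window_bound[where u = u and N = "Suc N", OF m window] by blast
  then have small: "?p ^ n * rat_padic_abs CARD('p) (s n) \<le> C" for n
    by (simp add: u_def padic_abs_of_rat)

  have "b n 0 = 1" for n
    using b(1)[of n 0] by (simp add: jp_quotient_def)
  then have zero: "s n = 0" for n
    using recurrence_zero_if_padically_small[OF p s(2) b(2,3) _ small] by blast
  obtain i where i: "i \<le> m" "c i \<noteq> 0" using c(1) by blast
  have "s (if i = 0 then 0 else m + 1 - i) = c i"
    using s(1)[of "if i = 0 then 0 else m + 1 - i"] i(1) by (auto simp: init_def split: if_splits)
  then show False using i(2) zero by simp
qed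

end
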